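(* Let $1<s<\infty$, $\frac1s+\frac1{s'}=1$, and let $\psi\in\mathfrak{M}''_{\infty}$ be differentiable and such that $\frac{\psi(t)}{|\psi'(t)|}$ increases monotonically to $\infty$ as $t\to\infty$. Then for every $\beta\in\mathbb{R}$, $$e^{\bot}_{2n-1}(L^{\psi}_{\beta,1})_{s}\asymp e^{\bot}_{2n}(L^{\psi}_{\beta,1})_{s}\asymp \psi(n)\,(\eta(n)-n)^{1/s'},\qquad n\in\mathbb{N}.$$
   Context: $L_p$ ($1\le p<\infty$) is the space of $2\pi$-periodic functions with $\|f\|_p=(\int_0^{2\pi}|f|^p)^{1/p}<\infty$; $L_\infty$ is the space of essentially bounded $2\pi$-periodic measurable functions with the ess sup norm. For $f\in L_1$, $\hat f(k)=\frac{1}{2\pi}\int_{-\pi}^{\pi}f(t)e^{-ikt}dt$. Given a sequence $\psi(k)$ and $\beta\in\mathbb{R}$, if $\sum_{k\in\mathbb{Z}\setminus\{0\}}\frac{\hat f(k)}{\psi(|k|)}e^{i(kx+\frac{\beta\pi}{2}\mathrm{sign}\,k)}$ is the Fourier series of some $\varphi\in L_1$, then $\varphi=:f^{\psi}_{\beta}$ is the $(\psi,\beta)$-derivative of $f$. Let $B^0_p=\{\varphi\in L_p:\|\varphi\|_p\le1,\ \int_{-\pi}^{\pi}\varphi=0\}$; the class $L^{\psi}_{\beta,p}$ is the set of $f$ whose $(\psi,\beta)$-derivative exists and belongs to $B^0_p$. $\mathfrak{M}$ is the set of convex (downward), continuous functions $\psi(t)$, $t\ge1$, with $\psi(t)\to0$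 as $t\to\infty$; the sequence $\psi(k)$ defining the class is the restriction of $\psi\in\mathfrak{M}$ to $\mathbb{N}$. For $\psi\in\mathfrak{M}$, $\eta(t)=\eta(\psi;t)=\psi^{-1}(\psi(t)/2)$ and $\mu(t)=\mu(\psi;t)=\frac{t}{\eta(t)-t}$. $\mathfrak{M}^+_\infty=\{\psi\in\mathfrak{M}:\mu(\psi;t)\text{ increases monotonically to }\infty\}$, and $\mathfrak{M}''_\infty=\{\psi\in\mathfrak{M}^+_\infty:\exists K>0\text{ with }\eta(\psi;t)-t\ge K\ \forall t\ge1\}$. For $f\in L_1$, $1\le s\le\infty$, $m\in\mathbb{N}$: $e^{\bot}_m(f)_s=\inf_{\gamma_m}\|f-\sum_{k\in\gamma_m}\hat f(k)e^{ik\cdot}\|_s$, the infimum over all sets $\gamma_m$ of $m$ integers, and $e^{\bot}_m(L^{\psi}_{\beta,p})_s=\sup_{f\in L^{\psi}_{\beta,p}}e^{\bot}_m(f)_s$. $a_n\asymp b_n$ means $C_1a_n\le b_n\le C_2a_n$ for all $n$ with positive constants $C_1,C_2$ independent of $n$. *)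

theory Defs
  imports "HOL-Analysis.Analysis"
begin

definition periodic2pi :: "(real \<Rightarrow> 'a) \<Rightarrow> bool" where
  "periodic2pi f \<longleftrightarrow> (\<forall>x. f (x + 2 * pi) = f x)"

definition Lp_norm :: "real \<Rightarrow> (real \<Rightarrow> complex) \<Rightarrow> ennreal" where
  "Lp_norm p f =
     (let I = (\<integral>\<^sup>+ x. indicator {0..2*pi} x * ennreal (cmod (f x) powr p) \<partial>lborel)
      in if I = \<infinity> then \<infinity> else ennreal ((enn2real I) powr (1 / p)))"

definition in_Lp :: "real \<Rightarrow> (real \<Rightarrow> real) \<Rightarrow> bool" where
  "in_Lp p f \<longleftrightarrow> f \<in> borel_measurable lborel \<and> periodic2pi f \<and>
     Lp_norm p (\<lambda>x. complex_of_real (f x)) < \<infinity>"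

definition fourier_coeff :: "(real \<Rightarrow> real) \<Rightarrow> int \<Rightarrow> complex" where
  "fourier_coeff f k = (1 / (2 * pi)) *
     set_lebesgue_integral lborel {-pi..pi}
       (\<lambda>t. complex_of_real (f t) * cis (- (real_of_int k * t)))"

definition is_psi_beta_deriv ::
  "(real \<Rightarrow> real) \<Rightarrow> real \<Rightarrow> (real \<Rightarrow> real) \<Rightarrow> (real \<Rightarrow> real) \<Rightarrow> bool" where
  "is_psi_beta_deriv \<psi> \<beta> f \<phi> \<longleftrightarrow> in_Lp 1 \<phi> \<and>
     fourier_coeff \<phi> 0 = 0 \<and>
     (\<forall>k::int. k \<noteq> 0 \<longrightarrow>
        fourier_coeff \<phi> k = fourier_coeff f k / complex_of_real (\<psi> (real_of_int \<bar>k\<bar>))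
                             * cis (\<beta> * pi / 2 * real_of_int (sgn k)))"

definition B0 :: "real \<Rightarrow> (real \<Rightarrow> real) set" where
  "B0 p = {\<phi>. in_Lp p \<phi> \<and> Lp_norm p (\<lambda>x. complex_of_real (\<phi> x)) \<le> 1 \<and>
               set_lebesgue_integral lborel {-pi..pi} \<phi> = 0}"

definition L_class :: "(real \<Rightarrow> real) \<Rightarrow> real \<Rightarrow> real \<Rightarrow> (real \<Rightarrow> real) set" where
  "L_class \<psi> \<beta> p = {f. in_Lp 1 f \<and> (\<exists>\<phi>. is_psi_beta_deriv \<psi> \<beta> f \<phi> \<and> \<phi> \<in> B0 p)}"

definition e_orth :: "nat \<Rightarrow> (real \<Rightarrow> real) \<Rightarrow> real \<Rightarrow> ennreal" where
  "e_orth m f s = (INF \<gamma>\<in>{\<gamma>::int set. finite \<gamma> \<and> card \<gamma> = m}.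
      Lp_norm s (\<lambda>x. complex_of_real (f x) -
                       (\<Sum>k\<in>\<gamma>. fourier_coeff f k * cis (real_of_int k * x))))"

definition e_orth_class :: "nat \<Rightarrow> (real \<Rightarrow> real) set \<Rightarrow> real \<Rightarrow> ennreal" where
  "e_orth_class m F s = (SUP f\<in>F. e_orth m f s)"

text \<open>The set M (functions on [1,oo)); positivity is part of Stepanets' standard definition.\<close>
definition class_M :: "(real \<Rightarrow> real) set" where
  "class_M = {\<psi>. convex_on {1..} \<psi> \<and> continuous_on {1..} \<psi> \<and>
                 (\<forall>t\<ge>1. \<psi> t > 0) \<and> (\<psi> \<longlongrightarrow> 0) at_top}"

definition eta :: "(real \<Rightarrow> real) \<Rightarrow> real \<Rightarrow> real" where
  "eta \<psi> t = (THE u. u \<ge> 1 \<and> \<psi> u = \<psi> t / 2)"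

definition mu :: "(real \<Rightarrow> real) \<Rightarrow> real \<Rightarrow> real" where
  "mu \<psi> t = t / (eta \<psi> t - t)"

definition class_M_plus_inf :: "(real \<Rightarrow> real) set" where
  "class_M_plus_inf = {\<psi>\<in>class_M. mono_on {1..} (mu \<psi>) \<and> filterlim (mu \<psi>) at_top at_top}"

definition class_M_pp_inf :: "(real \<Rightarrow> real) set" where
  "class_M_pp_inf = {\<psi>\<in>class_M_plus_inf. \<exists>K>0. \<forall>t\<ge>1. eta \<psi> t - t \<ge> K}"

end

theory Submission
  imports Defs
begin

text \<open>Write \<open>lam(n) = eta(n) - n\<close> and \<open>alpha = psi / |psi'|\<close>.

  Upper bound: removing the frequencies \<open>-p < k < q\<close> with \<open>p, q\<close> equal to \<open>n\<close> or \<open>n + 1\<close> leaves the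
  convolution of the \<open>(psi, beta)\<close>-derivative with the tail kernel \<open>Phi\<close> of \<open>psi\<close>, so by Young's
  inequality it suffices to bound the \<open>L_s\<close> norm of \<open>Phi\<close>. Abel summation gives
  \<open>|Phi(x)| \<le> C psi(n) / |x|\<close>, and since \<open>mu\<close> increases to infinity the iterates of \<open>eta\<close> give
  \<open>|Phi(x)| \<le> C psi(n) lam(n)\<close>; together, the norm is of order \<open>psi(n) lam(n)^(1/s')\<close>.

  Lower bound: take as derivative a Fejer kernel without its mean. Whatever \<open>2n\<close> frequencies are
  removed, at least \<open>2 lam(n)\<close> of those with \<open>0 < |k| \<le> M\<close> survive, where \<open>M\<close> is the first integer above
  \<open>eta(n)\<close>. Pairing with the polynomial \<open>g\<close> whose coefficients are \<open>psi(n) / psi(|k|)\<close> up to phase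
  makes every surviving frequency contribute about \<open>psi(n)\<close>. The monotonicity of \<open>alpha\<close> makes these
  coefficients decay geometrically on the scale \<open>lam(n)\<close> below \<open>n\<close>, so \<open>g\<close> satisfies the same two
  kernel bounds and its dual norm is of order \<open>lam(n)^(1/s)\<close>.\<close>

text \<open>A member of the class is only an L_1 function with prescribed coefficients, so writing
  its remainder as a convolution needs an argument. The coefficients are dominated by the summable
  values \<open>\<psi> (real k)\<close>, hence the Fourier series converges uniformly, and the
  uniqueness theorem identifies its sum with f almost everywhere. The kernel estimates are then made
  only for finite sums, uniformly in their length, and Fatou's lemma carries them to f.

  For the lower bound the obstacle is that the removed set is arbitrary. The test polynomial
  therefore inverts the multiplier: every frequency in a symmetric block has comparable weight, and
  only the number of survivors matters, not their position. The Fejer kernel supplies the derivative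
  because it is nonnegative, so that its L_1 norm is its integral, while its coefficients stay
  bounded below on half of its spectrum.

  All constants must be uniform in n although \<open>eta \<psi> n\<close> is not an integer. The
  bound \<open>lam t \<ge> K\<close> absorbs each unit lost by rounding into a multiple of
  \<open>lam\<close>.\<close>

section \<open>Uniqueness of Fourier coefficients\<close>

text \<open>Integrability is part of the notion because the integral of a non-integrable function is
  0 by convention, which would satisfy the second clause trivially. Functions on the circle are
  modelled by functions on the line that vanish outside one period.\<close>

definition annihilates_chars :: "(real \<Rightarrow> complex) \<Rightarrow> bool" where
  "annihilates_chars F \<longleftrightarrow> integrable lborel F \<and> (\<forall>k::int. (LINT t|lborel. F t * cis (k * t)) = 0)"

lemma integrable_mult_bounded_complex:
  fixes F G :: "real \<Rightarrow> complex"
  assumes F: "integrable lborel F" and [measurable]: "G \<in> borel_measurable borel"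
    and B: "\<And>t. cmod (G t) \<le> B"
  shows "integrable lborel (\<lambda>t. F t * G t)"
proof (rule Bochner_Integration.integrable_bound)
  show "integrable lborel (\<lambda>t. B * cmod (F t))"
    using F by auto
  have [measurable]: "F \<in> borel_measurable borel" using F by auto
  show "(\<lambda>t. F t * G t) \<in> borel_measurable lborel" by measurable
  have "0 \<le> B" using B[of 0] norm_ge_zero order_trans by blast
  then show "AE t in lborel. norm (F t * G t) \<le> norm (B * cmod (F t))"
    using mult_right_mono[OF B norm_ge_zero] by (auto simp: norm_mult abs_mult mult.commute)
qed

lemma borel_measurable_cis [measurable]: "cis \<in> borel_measurable borel"
  by (intro borel_measurable_continuous_onI continuous_intros)

lemma annihilates_chars_mult_cis:
  assumes "annihilates_chars F"
  shows "annihilates_chars (\<lambda>t. F t * cis (of_int m * t))"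
  unfolding annihilates_chars_def
proof safe
  show "integrable lborel (\<lambda>t. F t * cis (of_int m * t))"
    by (rule integrable_mult_bounded_complex[where B=1])
       (use assms in \<open>auto simp: annihilates_chars_def\<close>)
  fix k :: int
  have "(\<lambda>t. F t * cis (of_int m * t) * cis (of_int k * t)) = (\<lambda>t. F t * cis (of_int (m + k) * t))"
    by (auto simp: cis_mult ring_distribs mult.assoc)
  then show "(LINT t|lborel. F t * cis (of_int m * t) * cis (of_int k * t)) = 0"
    using assms by (simp only: annihilates_chars_def)
qed

lemma annihilates_chars_add:
  assumes "annihilates_chars F" "annihilates_chars G"
  shows "annihilates_chars (\<lambda>t. F t + G t)"
  unfolding annihilates_chars_def
proof safe
  show "integrable lborel (\<lambda>t. F t + G t)"
    using assms by (auto simp: annihilates_chars_def)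
  fix k :: int
  have i: "integrable lborel (\<lambda>t. F t * cis (of_int k * t))" "integrable lborel (\<lambda>t. G t * cis (of_int k * t))"
    using annihilates_chars_mult_cis assms by (auto simp: annihilates_chars_def)
  show "(LINT t|lborel. (F t + G t) * cis (of_int k * t)) = 0"
    using assms i by (simp add: annihilates_chars_def ring_distribs)
qed

lemma annihilates_chars_cmult:
  assumes "annihilates_chars F"
  shows "annihilates_chars (\<lambda>t. F t * c)"
proof -
  have "(\<lambda>t. F t * c * cis (of_int k * t)) = (\<lambda>t. c * (F t * cis (of_int k * t)))" for k
    by (auto simp: ac_simps)
  then show ?thesis using assms
    by (auto simp: annihilates_chars_def)
qed

text \<open>Quantifying over all annihilating functions makes the class of good multipliers closed
  under products.\<close>
lemma annihilates_chars_mult_polynomial: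
  assumes "real_polynomial_function p"
  shows "annihilates_chars F \<Longrightarrow> annihilates_chars (\<lambda>t. F t * of_real (p (cis t)))"
  using assms
proof (induction arbitrary: F)
  case (linear p)
  interpret bounded_linear p by fact
  have p: "p (cis t) = cos t * p 1 + sin t * p \<i>" for t
  proof -
    have "cis t = cos t *\<^sub>R 1 + sin t *\<^sub>R \<i>" by (simp add: complex_eq_iff)
    then show ?thesis by (simp only: add scaleR real_scaleR_def)
  qed
  \<comment> \<open>Euler's formulas turn the real-linear functional of \<open>cis t\<close> into a
    combination of the characters of frequency 1 and -1.\<close>
  have "F t * of_real (p (cis t)) = F t * cis (of_int 1 * t) * ((p 1 - \<i> * p \<i>)/2)
      + F t * cis (of_int (-1) * t) * ((p 1 + \<i> * p \<i>)/2)" for t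
    unfolding p by (auto simp: complex_eq_iff field_simps)
  then show ?case
    using linear.prems
    by (simp only:) (intro annihilates_chars_add annihilates_chars_cmult annihilates_chars_mult_cis)
next
  case (const c)
  then show ?case by (rule annihilates_chars_cmult)
next
  case (add p q)
  then show ?case using annihilates_chars_add[OF add.IH]
    by (simp add: ring_distribs)
next
  case (mult p q)
  then show ?case using mult.IH(2)[OF mult.IH(1)]
    by (simp add: mult.assoc)
qed

text \<open>By Stone-Weierstrass on the unit circle, g is within e of a polynomial there, and
  polynomials are already annihilated; the error is at most e times the L_1 norm of F.\<close>

lemma annihilates_chars_continuous:
  assumes F: "annihilates_chars F" and g: "continuous_on UNIV g"
    and B: "\<And>z. \<bar>g z\<bar> \<le> (B::real)"
  shows "(LINT t|lborel. F t * of_real (g (cis t))) = 0"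
proof -
  have intF: "integrable lborel F" using F by (auto simp: annihilates_chars_def)
  have [measurable]: "F \<in> borel_measurable borel" using intF by auto
  have gm[measurable]: "g \<in> borel_measurable borel"
    using g by (rule borel_measurable_continuous_onI)
  have ig: "integrable lborel (\<lambda>t. F t * of_real (g (cis t)))"
    by (rule integrable_mult_bounded_complex[where B=B]) (use intF B in auto)
  have *: "cmod (LINT t|lborel. F t * of_real (g (cis t))) \<le> e * (LINT t|lborel. cmod (F t))"
    if e: "e > 0" for e
  proof -
    obtain p where p: "real_polynomial_function p"
      and pe: "\<And>z. z \<in> sphere (0::complex) 1 \<Longrightarrow> \<bar>g z - p z\<bar> < e"
      using Stone_Weierstrass_real_polynomial_function[of "sphere (0::complex) 1" g e] e g
        continuous_on_subset by (metis compact_sphere subset_UNIV)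
    have n: "annihilates_chars (\<lambda>t. F t * of_real (p (cis t)))"
      by (rule annihilates_chars_mult_polynomial[OF p F])
    have ip: "integrable lborel (\<lambda>t. F t * of_real (p (cis t)))"
      and p0: "(LINT t|lborel. F t * of_real (p (cis t))) = 0"
      using n by (auto simp: annihilates_chars_def dest!: spec[of _ 0])
    have "(LINT t|lborel. F t * of_real (g (cis t)))
      = (LINT t|lborel. F t * of_real (g (cis t)) - F t * of_real (p (cis t)))"
      using ig ip p0 by simp
    also have "cmod \<dots> \<le> (LINT t|lborel. e * cmod (F t))"
    proof (rule order_trans[OF integral_norm_bound integral_mono])
      show "integrable lborel (\<lambda>x. cmod (F x * of_real (g (cis x)) - F x * of_real (p (cis x))))"
        using ig ip by auto
      show "integrable lborel (\<lambda>x. e * cmod (F x))" using intF by auto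
      fix t
      have "F t * of_real (g (cis t)) - F t * of_real (p (cis t)) = F t * of_real (g (cis t) - p (cis t))"
        by (simp add: ring_distribs)
      moreover have "\<bar>g (cis t) - p (cis t)\<bar> \<le> e" using pe[of "cis t"] by simp
      ultimately show "cmod (F t * of_real (g (cis t)) - F t * of_real (p (cis t))) \<le> e * cmod (F t)"
        using mult_left_mono[of "\<bar>g (cis t) - p (cis t)\<bar>" e "cmod (F t)"]
        by (simp add: norm_mult mult.commute del: of_real_diff)
    qed
    finally show ?thesis by simp
  qed
  let ?I = "LINT t|lborel. cmod (F t)"
  \<comment> \<open>Taking e as \<open>d / (?I + 1)\<close> makes the error at most d without
    treating \<open>?I = 0\<close> separately.\<close>
  have "cmod (LINT t|lborel. F t * of_real (g (cis t))) \<le> 0 + d" if "d > 0" for d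
  proof -
    have I: "?I \<ge> 0" by simp
    have "y / (y + 1) \<le> 1" if "y \<ge> 0" for y :: real using that by simp
    then have "?I / (?I + 1) \<le> 1" using I by blast
    then have "d * (?I / (?I + 1)) \<le> d" using that by (intro mult_left_le) auto
    then have "d / (?I + 1) * ?I \<le> d" by simp
    have "?I + 1 > 0" using I by (rule add_nonneg_pos) simp
    then have "d / (?I + 1) > 0" using that by (rule divide_pos_pos[rotated])
    from *[OF this] \<open>d / (?I + 1) * ?I \<le> d\<close> show ?thesis by linarith
  qed
  then have "cmod (LINT t|lborel. F t * of_real (g (cis t))) \<le> 0"
    by (rule field_le_epsilon)
  then show ?thesis by simp
qed

text \<open>One strict inequality suffices: it rules out the pair of endpoints -pi and pi, the only
  points of the closed period with a common image.\<close>

lemma cis_inj_open: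
  assumes "cis t = cis u" "\<bar>t\<bar> < pi" "\<bar>u\<bar> \<le> pi"
  shows "t = u"
proof -
  have "cis (t - u) = 1" using assms(1) by (simp flip: cis_divide)
  then have "cos (t - u) = 1" by (simp add: complex_eq_iff)
  then obtain n :: int where n: "t - u = of_int n * 2 * pi" using cos_one_2pi_int by blast
  have "\<bar>of_int n * 2 * pi\<bar> < 2 * pi" using assms(2,3) n by linarith
  then have "\<bar>real_of_int n\<bar> < 1" by (simp add: abs_mult)
  then have "n = 0" by linarith
  then show ?thesis using n by simp
qed

text \<open>On the support of F, the indicator of C is almost everywhere a limit of continuous
  functions of \<open>cis t\<close>, namely tent functions of the distance to the compact image of C
  on the circle. Dominated convergence passes to the limit.\<close>

lemma annihilates_chars_closed:
  assumes F: "annihilates_chars F" and supp: "\<And>t. t \<notin> {-pi..pi} \<Longrightarrow> F t = 0" and C: "closed C"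
  shows "set_lebesgue_integral lborel C F = 0"
proof (cases "C \<inter> {-pi..pi} = {}")
  case True
  then have "(\<lambda>x. indicator C x *\<^sub>R F x) = (\<lambda>_. 0)" using supp by (fastforce simp: indicator_def)
  then show ?thesis by (simp add: set_lebesgue_integral_def)
next
  case False
  define K where "K = cis ` (C \<inter> {-pi..pi})"
  have K: "compact K" "K \<noteq> {}"
    unfolding K_def using C False
    by (auto intro!: compact_continuous_image continuous_intros closed_Int_compact)
  define h where "h n z = max 0 (1 - real n * infdist z K)" for n :: nat and z
  have hc: "continuous_on UNIV (h n)" for n
    unfolding h_def by (intro continuous_intros)
  have hB: "\<bar>h n z\<bar> \<le> 1" for n z unfolding h_def using infdist_nonneg[of z K] by (auto simp: max_def)
  have intF: "integrable lborel F" using F by (auto simp: annihilates_chars_def)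
  have [measurable]: "F \<in> borel_measurable borel" using intF by auto
  have [measurable]: "h n \<in> borel_measurable borel" for n
    using hc by (rule borel_measurable_continuous_onI)
  have [measurable]: "C \<in> sets borel" using C by auto
  have "(\<lambda>n. LINT t|lborel. F t * of_real (h n (cis t))) \<longlonglongrightarrow> (LINT t|lborel. indicator C t *\<^sub>R F t)"
  proof (rule integral_dominated_convergence)
    show "integrable lborel (\<lambda>t. cmod (F t))" using intF by auto
    show "AE t in lborel. cmod (F t * of_real (h n (cis t))) \<le> cmod (F t)" for n
      using hB by (auto simp: norm_mult intro!: mult_left_le)
    \<comment> \<open>Both endpoints are mapped to -1, so only away from this null set does
      \<open>cis t \<in> K\<close> decide whether t lies in C.\<close>
    have "AE t in lborel. t \<noteq> -pi" "AE t in lborel. t \<noteq> pi"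
      by (rule AE_lborel_singleton)+
    then show "AE t in lborel. (\<lambda>n. F t * of_real (h n (cis t))) \<longlonglongrightarrow> indicator C t *\<^sub>R F t"
    proof eventually_elim
      case (elim t)
      show ?case
      proof (cases "t \<in> {-pi..pi}")
        case False
        then show ?thesis using supp by simp
      next
        case t: True
        have CK: "t \<in> C \<longleftrightarrow> cis t \<in> K"
        proof
          assume "cis t \<in> K"
          then obtain u where u: "u \<in> C" "u \<in> {-pi..pi}" "cis t = cis u" by (auto simp: K_def)
          then have "t = u" using t elim by (intro cis_inj_open) auto
          then show "t \<in> C" using u by simp
        qed (use t in \<open>auto simp: K_def\<close>)
        have "(\<lambda>n. h n (cis t)) \<longlonglongrightarrow> indicator C t"
        proof (cases "t \<in> C")
          case True
          then have "h n (cis t) = 1" for n using CK by (simp add: h_def)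
          then show ?thesis using True by simp
        next
          case False
          then have p: "infdist (cis t) K > 0"
            using CK K infdist_pos_not_in_closed compact_imp_closed by blast
          have "\<forall>\<^sub>F n in sequentially. real n > 1 / infdist (cis t) K"
            by (rule eventually_gt_at_top[THEN filterlim_real_sequentially[THEN filterlim_iff[THEN iffD1], THEN spec, THEN mp]])
          then have "\<forall>\<^sub>F n in sequentially. h n (cis t) = indicator C t"
            by eventually_elim (use p False in \<open>auto simp: h_def field_simps\<close>)
          then show ?thesis by (rule tendsto_eventually)
        qed
        then have "(\<lambda>n. F t * of_real (h n (cis t))) \<longlonglongrightarrow> F t * of_real (indicator C t)"
          by (intro tendsto_intros)
        then show ?thesis by (auto simp: scaleR_conv_of_real mult.commute indicator_def split: if_splits)
      qed
    qed
  qed auto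
  moreover have "(LINT t|lborel. F t * of_real (h n (cis t))) = 0" for n
    by (rule annihilates_chars_continuous[OF F hc, where B=1]) (rule hB)
  ultimately have "(\<lambda>n::nat. 0::complex) \<longlonglongrightarrow> (LINT t|lborel. indicator C t *\<^sub>R F t)" by simp
  then show ?thesis
    by (simp add: set_lebesgue_integral_def LIMSEQ_const_iff)
qed

text \<open>The closed sets form an intersection-stable generator of the Borel sets. The integral of
  F vanishes on them, hence by Dynkin induction on every Borel set, so the density F is zero almost
  everywhere.\<close>

theorem annihilates_chars_AE_zero:
  assumes F: "annihilates_chars F" and supp: "\<And>t. t \<notin> {-pi..pi} \<Longrightarrow> F t = 0"
  shows "AE t in lborel. F t = 0"
proof (rule sigma_finite_measure.density_zero[OF sigma_finite_lborel])
  show intF: "integrable lborel F" using F by (auto simp: annihilates_chars_def)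
  fix A :: "real set" assume "A \<in> sets lborel"
  then have A: "A \<in> sigma_sets UNIV (Collect closed)"
    by (simp add: borel_eq_closed)
  have "Int_stable (Collect closed :: real set set)" by (auto simp: Int_stable_def)
  moreover have "Collect closed \<subseteq> Pow (UNIV::real set)" by auto
  moreover note A
  ultimately show "set_lebesgue_integral lborel A F = 0"
  proof (induction rule: sigma_sets_induct_disjoint)
    case (basic A)
    then show ?case using annihilates_chars_closed[OF F supp] by auto
  next
    case empty
    then show ?case by (simp add: set_lebesgue_integral_def)
  next
    case (compl A)
    have A: "A \<in> sets lborel" using compl by (simp add: borel_eq_closed)
    have U: "set_lebesgue_integral lborel UNIV F = 0"
      by (rule annihilates_chars_closed[OF F supp]) auto
    have "set_lebesgue_integral lborel (A \<union> (UNIV - A)) F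
      = set_lebesgue_integral lborel A F + set_lebesgue_integral lborel (UNIV - A) F"
      by (rule set_integral_Un) (use A intF in \<open>auto simp: set_integrable_def intro!: integrable_mult_indicator\<close>)
    moreover have "A \<union> (UNIV - A) = UNIV" by auto
    ultimately show ?case using U compl.IH by simp
  next
    case (union A)
    have A: "A i \<in> sets lborel" for i using union by (auto simp: borel_eq_closed)
    have "(LINT x:(\<Union>i. A i)|lborel. F x) = (\<Sum>i. (LINT x:A i|lborel. F x))"
      by (rule lebesgue_integral_countable_add)
        (use A intF union(1) in \<open>auto simp: set_integrable_def disjoint_family_on_def intro!: integrable_mult_indicator\<close>)
    then show ?case using union.IH by simp
  qed
qed

section \<open>Absolutely summable Fourier series\<close>

lemma set_integrable_bounded_circle:
  fixes G :: "real \<Rightarrow> complex"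
  assumes "G \<in> borel_measurable borel" "\<And>t. cmod (G t) \<le> B"
  shows "set_integrable lborel {-pi..pi} G"
proof -
  have "integrable lborel (\<lambda>t. indicator {-pi..pi} t *\<^sub>R (1::complex))"
    by (simp add: integrable_real_indicator)
  from integrable_mult_bounded_complex[OF this assms]
  show ?thesis by (simp add: set_integrable_def)
qed

lemma set_integrable_mult_cis:
  fixes F :: "real \<Rightarrow> complex"
  assumes "set_integrable lborel {-pi..pi} F"
  shows "set_integrable lborel {-pi..pi} (\<lambda>t. F t * cis (c * t))"
proof -
  have "integrable lborel (\<lambda>t. (indicator {-pi..pi} t *\<^sub>R F t) * cis (c * t))"
    using assms by (intro integrable_mult_bounded_complex[where B=1]) (auto simp: set_integrable_def)
  then show ?thesis by (simp add: set_integrable_def)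
qed

lemma integral_cis_circle:
  "(LINT t:{-pi..pi}|lborel. cis (real_of_int k * t)) = (if k = 0 then 2 * complex_of_real pi else 0)"
proof (cases "k = 0")
  case True
  then show ?thesis
    by (simp add: set_lebesgue_integral_def scaleR_conv_of_real)
next
  case False
  let ?F = "\<lambda>t. cis (real_of_int k * t) / (\<i> * of_int k)"
  have "(LINT t:{-pi..pi}|lborel. cis (real_of_int k * t)) = ?F pi - ?F (-pi)"
    unfolding set_lebesgue_integral_def
  proof (rule integral_FTC_Icc)
    show "(?F has_vector_derivative cis (real_of_int k * x)) (at x within {-pi..pi})" for x
      unfolding cis_conv_exp
      by (rule has_vector_derivative_real_field[THEN has_vector_derivative_at_within] 
          | (rule derivative_eq_intros refl)+ | use False in \<open>simp add: field_simps\<close>)+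
  qed (auto intro!: continuous_intros)
  also have "cis (real_of_int k * pi) = cis (real_of_int k * (-pi))"
    using sin_zero_iff_int2[of "real_of_int k * pi"] by (auto simp: complex_eq_iff)
  finally show ?thesis using False by simp
qed

lemma integral_trig_polynomial_cis:
  assumes A: "finite (A :: int set)"
  shows "(LINT t:{-pi..pi}|lborel. (\<Sum>k\<in>A. a k * cis (real_of_int k * t)) * cis (real_of_int m * t))
    = (if - m \<in> A then 2 * complex_of_real pi * a (- m) else 0)"
proof -
  have i: "set_integrable lborel {-pi..pi} (\<lambda>t. a k * cis (real_of_int (k + m) * t))" for k
    by (rule set_integrable_bounded_circle[where B = "cmod (a k)"]) (auto simp: norm_mult)
  have "(\<Sum>k\<in>A. a k * cis (real_of_int k * t)) * cis (real_of_int m * t)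
     = (\<Sum>k\<in>A. a k * cis (real_of_int (k + m) * t))" for t
    by (simp add: sum_distrib_right cis_mult ring_distribs mult.assoc)
  then have "(LINT t:{-pi..pi}|lborel. (\<Sum>k\<in>A. a k * cis (real_of_int k * t)) * cis (real_of_int m * t))
    = (LINT t:{-pi..pi}|lborel. (\<Sum>k\<in>A. a k * cis (real_of_int (k + m) * t)))"
    by simp
  also have "\<dots> = (\<Sum>k\<in>A. LINT t:{-pi..pi}|lborel. a k * cis (real_of_int (k + m) * t))"
    unfolding set_lebesgue_integral_def scaleR_sum_right
    by (rule Bochner_Integration.integral_sum) (rule i[unfolded set_integrable_def])
  also have "\<dots> = (\<Sum>k\<in>A. a k * (if k + m = 0 then 2 * complex_of_real pi else 0))"
    by (simp only: set_integral_mult_right integral_cis_circle)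
  also have "\<dots> = (\<Sum>k\<in>A. if k = - m then 2 * complex_of_real pi * a (- m) else 0)"
    by (intro sum.cong) (auto simp: add_eq_0_iff)
  also have "\<dots> = (if - m \<in> A then 2 * complex_of_real pi * a (- m) else 0)"
    using A by simp
  finally show ?thesis .
qed

text \<open>Stated at \<open>- k\<close> so that the integral has the form used in
  \<open>annihilates_chars\<close>.\<close>

lemma fourier_coeff_alt:
  "2 * complex_of_real pi * fourier_coeff f (- k) =
    (LINT t:{-pi..pi}|lborel. complex_of_real (f t) * cis (real_of_int k * t))"
  by (simp add: fourier_coeff_def)

lemma fourier_coeff_trig_polynomial:
  assumes "finite A" "\<And>t. complex_of_real (f t) = (\<Sum>k\<in>A. a k * cis (real_of_int k * t))"
  shows "fourier_coeff f k = (if k \<in> A then a k else 0)"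
  using fourier_coeff_alt[of f "- k"] integral_trig_polynomial_cis[OF assms(1), of a "- k"] assms(2)
  by (auto split: if_splits)

text \<open>The symmetric partial sums converge by the comparison test to a bounded g, whose
  coefficients are found by dominated convergence. They agree with those of f, so f - g annihilates
  all characters.\<close>

theorem fourier_series_AE_converges:
  fixes f :: "real \<Rightarrow> real"
  assumes f: "set_integrable lborel {-pi..pi} f"
    and b: "\<And>k. cmod (fourier_coeff f k) \<le> b (nat \<bar>k\<bar>)" and sb: "summable b"
  shows "AE t in lborel. t \<in> {-pi..pi} \<longrightarrow>
    (\<lambda>N. \<Sum>k\<in>{- int N..int N}. fourier_coeff f k * cis (real_of_int k * t)) \<longlonglongrightarrow> complex_of_real (f t)"
proof -
  define a where "a = fourier_coeff f"
  define S where "S N t = (\<Sum>k\<in>{- int N..int N}. a k * cis (real_of_int k * t))" for N t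
  \<comment> \<open>Pairing the frequencies j + 1 and -(j + 1) turns the symmetric sum over the
    integers into an ordinary series.\<close>
  define u where "u j t = a (int (Suc j)) * cis (real_of_int (int (Suc j)) * t)
     + a (- int (Suc j)) * cis (real_of_int (- int (Suc j)) * t)" for j t
  define g where "g t = a 0 + (\<Sum>j. u j t)" for t
  have fc: "set_integrable lborel {-pi..pi} (\<lambda>t. complex_of_real (f t))"
    using f by (simp add: set_integrable_def flip: of_real_mult add: scaleR_conv_of_real)
  have bn: "b j \<ge> 0" for j using order_trans[OF norm_ge_zero b[of "int j"]] by simp
  have [measurable]: "u j \<in> borel_measurable borel" for j unfolding u_def by measurable
  have [measurable]: "S j \<in> borel_measurable borel" for j unfolding S_def by measurable
  have [measurable]: "g \<in> borel_measurable borel" unfolding g_def by measurable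
  have u_le: "cmod (u j t) \<le> 2 * b (Suc j)" for j t
    unfolding u_def using b[of "int (Suc j)"] b[of "- int (Suc j)"]
    by (intro norm_triangle_le) (auto simp: norm_mult a_def nat_add_distrib)
  have s2: "summable (\<lambda>j. 2 * b (Suc j))" using sb by (intro summable_mult) (simp add: summable_Suc_iff)
  have su: "summable (\<lambda>j. u j t)" for t
    using u_le by (intro summable_comparison_test'[OF s2]) auto
  have S_eq: "S N t = a 0 + (\<Sum>j<N. u j t)" for N t
  proof (induction N)
    case (Suc N)
    have "{- int (Suc N)..int (Suc N)} = insert (int (Suc N)) (insert (- int (Suc N)) {- int N..int N})"
      by auto
    then have "S (Suc N) t = u N t + S N t" by (simp add: S_def u_def)
    then show ?case using Suc by simp
  qed (simp add: S_def)
  have S_lim: "(\<lambda>N. S N t) \<longlonglongrightarrow> g t" for t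
    unfolding S_eq g_def by (intro tendsto_intros summable_LIMSEQ su)
  define B where "B = b 0 + (\<Sum>j. 2 * b (Suc j))"
  have S_le: "cmod (S N t) \<le> B" for N t
  proof -
    have "cmod (\<Sum>j<N. u j t) \<le> (\<Sum>j<N. 2 * b (Suc j))" by (intro sum_norm_le u_le)
    also have "\<dots> \<le> (\<Sum>j. 2 * b (Suc j))" using bn by (intro sum_le_suminf s2) auto
    finally show ?thesis unfolding S_eq B_def using b[of 0]
      by (intro norm_triangle_le) (auto simp: a_def)
  qed
  have g_le: "cmod (g t) \<le> B" for t
    by (rule LIMSEQ_le_const2[OF tendsto_norm[OF S_lim]]) (use S_le in auto)
  have ig: "set_integrable lborel {-pi..pi} g"
    using g_le by (intro set_integrable_bounded_circle) auto
  define F where "F t = indicator {-pi..pi} t *\<^sub>R (complex_of_real (f t) - g t)" for t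
  have "annihilates_chars F"
    unfolding annihilates_chars_def
  proof safe
    show "integrable lborel F"
      using set_integral_diff(1)[OF fc ig] by (simp add: F_def[abs_def] set_integrable_def)
    fix k :: int
    have "(\<lambda>N. LINT t:{-pi..pi}|lborel. S N t * cis (real_of_int k * t))
        \<longlonglongrightarrow> (LINT t:{-pi..pi}|lborel. g t * cis (real_of_int k * t))"
      unfolding set_lebesgue_integral_def
    proof (rule integral_dominated_convergence[where w = "\<lambda>t. indicator {-pi..pi} t * B"])
      show "AE t in lborel. (\<lambda>N. indicator {-pi..pi} t *\<^sub>R (S N t * cis (real_of_int k * t)))
         \<longlonglongrightarrow> indicator {-pi..pi} t *\<^sub>R (g t * cis (real_of_int k * t))"
        by (intro AE_I2 tendsto_intros S_lim)
      show "AE t in lborel. norm (indicator {-pi..pi} t *\<^sub>R (S N t * cis (real_of_int k * t)))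
          \<le> indicator {-pi..pi} t * B" for N
        using S_le by (auto simp: norm_mult indicator_def)
    qed auto
    \<comment> \<open>Once N is at least |k|, the partial sum contains the frequency
      \<open>- k\<close> and the integral no longer depends on N.\<close>
    moreover have "\<forall>\<^sub>F N in sequentially. (LINT t:{-pi..pi}|lborel. S N t * cis (real_of_int k * t))
       = 2 * complex_of_real pi * a (- k)"
      using eventually_ge_at_top[of "nat \<bar>k\<bar>"]
      by eventually_elim (auto simp: S_def integral_trig_polynomial_cis)
    ultimately have "(LINT t:{-pi..pi}|lborel. g t * cis (real_of_int k * t)) = 2 * complex_of_real pi * a (- k)"
      by (rule LIMSEQ_unique[OF _ tendsto_eventually])
    moreover have "(LINT t|lborel. F t * cis (real_of_int k * t))
      = (LINT t:{-pi..pi}|lborel. complex_of_real (f t) * cis (real_of_int k * t) - g t * cis (real_of_int k * t))"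
    proof -
      have "F t * cis (real_of_int k * t) = indicator {-pi..pi} t *\<^sub>R
          (complex_of_real (f t) * cis (real_of_int k * t) - g t * cis (real_of_int k * t))" for t
        by (simp add: F_def left_diff_distrib)
      then show ?thesis by (simp add: set_lebesgue_integral_def)
    qed
    ultimately show "(LINT t|lborel. F t * cis (real_of_int k * t)) = 0"
      using set_integral_diff(2)[OF set_integrable_mult_cis[OF fc] set_integrable_mult_cis[OF ig], of k k]
        fourier_coeff_alt[of f k]
      by (simp add: a_def)
  qed
  then have "AE t in lborel. F t = 0"
    by (rule annihilates_chars_AE_zero) (simp add: F_def)
  then show ?thesis
  proof eventually_elim
    case (elim t)
    then show ?case using S_lim[of t] by (auto simp: F_def S_def a_def)
  qed
qed

section \<open>Integral inequalities\<close>

text \<open>Young's inequality is applied pointwise to u / A and v / B; the weights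
  \<open>?a\<close> and \<open>?b\<close> make the integrated right-hand side equal to A B (1/p +
  1/q). Nonnegative integrals avoid any integrability condition on the product.\<close>

lemma nn_integral_Holder:
  fixes u v :: "'a \<Rightarrow> real"
  assumes pq: "p > 1" "q > 1" "1 / p + 1 / q = 1"
    and [measurable]: "u \<in> borel_measurable M" "v \<in> borel_measurable M"
    and nn: "\<And>x. u x \<ge> 0" "\<And>x. v x \<ge> 0" and AB: "A > 0" "B > 0"
    and u: "(\<integral>\<^sup>+x. ennreal (u x powr p) \<partial>M) \<le> ennreal (A powr p)"
    and v: "(\<integral>\<^sup>+x. ennreal (v x powr q) \<partial>M) \<le> ennreal (B powr q)"
  shows "(\<integral>\<^sup>+x. ennreal (u x * v x) \<partial>M) \<le> ennreal (A * B)"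
proof -
  let ?a = "A * B / (p * A powr p)" and ?b = "A * B / (q * B powr q)"
  have pos: "?a \<ge> 0" "?b \<ge> 0" using pq AB by auto
  have lin: "ennreal (a * X + b * Y) = ennreal a * ennreal X + ennreal b * ennreal Y"
    if "a \<ge> 0" "b \<ge> 0" "X \<ge> 0" "Y \<ge> 0" for a b X Y
    using that by (simp add: ennreal_mult)
  have "u x * v x \<le> ?a * u x powr p + ?b * v x powr q" for x
  proof -
    have "(u x / A) * (v x / B) \<le> (u x / A) powr p / p + (v x / B) powr q / q"
      using nn[of x] AB pq by (intro Youngs_inequality) auto
    then have "A * B * ((u x / A) * (v x / B)) \<le> A * B * ((u x / A) powr p / p + (v x / B) powr q / q)"
      using AB by (intro mult_left_mono) auto
    also have "\<dots> = ?a * u x powr p + ?b * v x powr q"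
      using nn[of x] AB by (simp add: powr_divide ring_distribs mult.commute)
    finally show ?thesis using AB by simp
  qed
  then have "ennreal (u x * v x) \<le> ennreal ?a * ennreal (u x powr p) + ennreal ?b * ennreal (v x powr q)" for x
    using pos by (subst lin[symmetric]) (auto intro: ennreal_leI)
  then have "(\<integral>\<^sup>+x. ennreal (u x * v x) \<partial>M)
     \<le> (\<integral>\<^sup>+x. ennreal ?a * ennreal (u x powr p) + ennreal ?b * ennreal (v x powr q) \<partial>M)"
    by (intro nn_integral_mono)
  also have "\<dots> = ennreal ?a * (\<integral>\<^sup>+x. ennreal (u x powr p) \<partial>M) + ennreal ?b * (\<integral>\<^sup>+x. ennreal (v x powr q) \<partial>M)"
    by (simp add: nn_integral_add nn_integral_cmult)
  also have "\<dots> \<le> ennreal ?a * ennreal (A powr p) + ennreal ?b * ennreal (B powr q)"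
    by (intro add_mono mult_left_mono u v) auto
  also have "\<dots> = ennreal (?a * A powr p + ?b * B powr q)"
    using pos by (subst lin) auto
  also have "?a * A powr p + ?b * B powr q = A * B * (1 / p + 1 / q)"
    using AB pq by (simp add: field_simps)
  finally show ?thesis using pq by simp
qed

section \<open>Integrals over one period and L_p norms\<close>

lemma nn_integral_period_shift:
  fixes g :: "real \<Rightarrow> ennreal"
  assumes [measurable]: "g \<in> borel_measurable borel" and per: "\<And>x. g (x + 2 * pi) = g x"
    and ab: "a \<le> b" "b \<le> a + 2 * pi"
  shows "(\<integral>\<^sup>+x\<in>{a..a + 2 * pi}. g x \<partial>lborel) = (\<integral>\<^sup>+x\<in>{b..b + 2 * pi}. g x \<partial>lborel)"
proof -
  let ?J = "\<lambda>c d. \<integral>\<^sup>+x\<in>{c..d}. g x \<partial>lborel"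
  have split: "?J c e = ?J c d + ?J d e" if "c \<le> d" "d \<le> e" for c d e
  proof -
    have "?J c e = (\<integral>\<^sup>+x. g x * indicator {c..d} x + g x * indicator {d..e} x \<partial>lborel)"
      by (rule nn_integral_cong_AE)
         (use AE_lborel_singleton[of d] in eventually_elim, use that in \<open>auto simp: indicator_def\<close>)
    then show ?thesis by (simp add: nn_integral_add)
  qed
  have "?J (a + 2 * pi) (b + 2 * pi) = ?J a b"
    using nn_integral_real_affine[of "\<lambda>x. g x * indicator {a + 2 * pi..b + 2 * pi} x" 1 "2 * pi"] per
    by (simp add: add.commute indicator_def)
  moreover have "?J b (b + 2 * pi) = ?J b (a + 2 * pi) + ?J (a + 2 * pi) (b + 2 * pi)"
    "?J a (a + 2 * pi) = ?J a b + ?J b (a + 2 * pi)"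
    using ab by (intro split; simp)+
  ultimately show ?thesis by (simp add: add.commute)
qed

lemma nn_integral_period_0_2pi:
  fixes g :: "real \<Rightarrow> ennreal"
  assumes "g \<in> borel_measurable borel" "\<And>x. g (x + 2 * pi) = g x"
  shows "(\<integral>\<^sup>+x\<in>{0..2 * pi}. g x \<partial>lborel) = (\<integral>\<^sup>+x\<in>{-pi..pi}. g x \<partial>lborel)"
  using nn_integral_period_shift[OF assms, of "-pi" 0] by simp

lemma nn_integral_period_reflect:
  fixes g :: "real \<Rightarrow> ennreal"
  assumes [measurable]: "g \<in> borel_measurable borel" and per: "\<And>x. g (x + 2 * pi) = g x"
    and t: "\<bar>t\<bar> \<le> pi"
  shows "(\<integral>\<^sup>+x\<in>{-pi..pi}. g (x - t) \<partial>lborel) = (\<integral>\<^sup>+x\<in>{-pi..pi}. g x \<partial>lborel)"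
proof -
  have "(\<integral>\<^sup>+x\<in>{-pi..pi}. g (x - t) \<partial>lborel) = (\<integral>\<^sup>+x\<in>{-pi-t..-pi-t+2*pi}. g x \<partial>lborel)"
    using nn_integral_real_affine[of "\<lambda>x. g (x - t) * indicator {-pi..pi} x" 1 t]
    by (simp add: indicator_def algebra_simps)
  also have "\<dots> = (\<integral>\<^sup>+x\<in>{-pi..-pi+2*pi}. g x \<partial>lborel)"
  proof (cases "t \<ge> 0")
    case True
    then show ?thesis using t by (intro nn_integral_period_shift[OF assms(1) per]) auto
  next
    case False
    then show ?thesis using t by (intro nn_integral_period_shift[OF assms(1) per, symmetric]) auto
  qed
  finally show ?thesis by simp
qed

text \<open>This passes from the norm over [0, 2 pi], with its root and its infinite case, to p-th
  power integrals over the symmetric period, in which all estimates are made.\<close>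

lemma Lp_norm_le_iff:
  assumes [measurable]: "F \<in> borel_measurable borel" and per: "periodic2pi F"
    and p: "p > 0" and B: "B \<ge> 0"
  shows "Lp_norm p F \<le> ennreal B \<longleftrightarrow>
    (\<integral>\<^sup>+x\<in>{-pi..pi}. ennreal (cmod (F x) powr p) \<partial>lborel) \<le> ennreal (B powr p)"
proof -
  define I where "I = (\<integral>\<^sup>+x\<in>{-pi..pi}. ennreal (cmod (F x) powr p) \<partial>lborel)"
  have "(\<integral>\<^sup>+ x. indicator {0..2*pi} x * ennreal (cmod (F x) powr p) \<partial>lborel) = I"
    unfolding I_def using per
    by (subst nn_integral_period_0_2pi[symmetric]) (auto simp: mult.commute periodic2pi_def)
  then have L: "Lp_norm p F = (if I = \<infinity> then \<infinity> else ennreal (enn2real I powr (1 / p)))"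
    by (simp add: Lp_norm_def)
  show ?thesis unfolding I_def[symmetric] L
  proof (cases I)
    case (real r)
    have "r powr (1/p) \<le> B \<longleftrightarrow> r \<le> B powr p"
    proof
      assume "r powr (1/p) \<le> B"
      then have "(r powr (1/p)) powr p \<le> B powr p" using p by (intro powr_mono2) auto
      then show "r \<le> B powr p" using p real by (simp add: powr_powr)
    next
      assume "r \<le> B powr p"
      then have "r powr (1/p) \<le> (B powr p) powr (1/p)" using p real by (intro powr_mono2) auto
      then show "r powr (1/p) \<le> B" using p B by (simp add: powr_powr)
    qed
    then show "(if I = \<infinity> then \<infinity> else ennreal (enn2real I powr (1 / p))) \<le> ennreal B \<longleftrightarrow> I \<le> ennreal (B powr p)"
      using real B by simp
  qed (auto simp: top_unique)
qed

text \<open>Young's convolution inequality. Splitting the density into its powers 1/p and 1/q and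
  applying Holder gives Jensen's inequality for a mass of at most 1; then Tonelli and translation
  invariance finish. The function r need only be dominated by the convolution, which leaves room for
  a constant factor.\<close>

lemma nn_integral_convolution_powr_le:
  fixes \<phi> :: "real \<Rightarrow> real" and \<Phi> r :: "real \<Rightarrow> complex"
  assumes p: "p > 1"
    and [measurable]: "\<phi> \<in> borel_measurable borel" "\<Phi> \<in> borel_measurable borel"
    and \<phi>: "(\<integral>\<^sup>+t\<in>{-pi..pi}. ennreal \<bar>\<phi> t\<bar> \<partial>lborel) \<le> 1"
    and per: "periodic2pi \<Phi>"
    and r: "\<And>x. ennreal (cmod (r x)) \<le> (\<integral>\<^sup>+t\<in>{-pi..pi}. ennreal (\<bar>\<phi> t\<bar> * cmod (\<Phi> (x - t))) \<partial>lborel)"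
  shows "(\<integral>\<^sup>+x\<in>{-pi..pi}. ennreal (cmod (r x) powr p) \<partial>lborel)
    \<le> (\<integral>\<^sup>+x\<in>{-pi..pi}. ennreal (cmod (\<Phi> x) powr p) \<partial>lborel)"
proof -
  define q where "q = p / (p - 1)"
  have q: "q > 1" "1 / p + 1 / q = 1" using p by (auto simp: q_def field_simps)
  define J where "J x = (\<integral>\<^sup>+t\<in>{-pi..pi}. ennreal (\<bar>\<phi> t\<bar> * cmod (\<Phi> (x - t)) powr p) \<partial>lborel)" for x
  have Jensen: "ennreal (cmod (r x) powr p) \<le> J x" for x
  proof (cases "J x")
    case (real j)
    \<comment> \<open>The added e keeps A positive when \<open>J x\<close> is 0, as Holder's
      inequality requires; it is removed at the end.\<close>
    have "cmod (r x) powr p \<le> j + e" if "e > 0" for e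
    proof -
      define A where "A = (j + e) powr (1 / p)"
      have A: "A > 0" "A powr p = j + e" using that real p by (auto simp: A_def powr_powr)
      let ?u = "\<lambda>t. indicator {-pi..pi} t * (\<bar>\<phi> t\<bar> powr (1/p) * cmod (\<Phi> (x - t)))"
      let ?v = "\<lambda>t. indicator {-pi..pi} t * \<bar>\<phi> t\<bar> powr (1/q)"
      have u: "?u t powr p = \<bar>\<phi> t\<bar> * cmod (\<Phi> (x - t)) powr p * indicator {-pi..pi} t" for t
        using p by (auto simp: indicator_def powr_mult powr_powr)
      have v: "?v t powr q = \<bar>\<phi> t\<bar> * indicator {-pi..pi} t" for t
        using q by (auto simp: indicator_def powr_mult powr_powr)
      have uv: "?u t * ?v t = \<bar>\<phi> t\<bar> * cmod (\<Phi> (x - t)) * indicator {-pi..pi} t" for t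
      proof -
        have "\<bar>\<phi> t\<bar> powr (1/p) * \<bar>\<phi> t\<bar> powr (1/q) = \<bar>\<phi> t\<bar>"
          using q by (simp flip: powr_add)
        then show ?thesis by (auto simp: indicator_def)
      qed
      have "(\<integral>\<^sup>+t. ennreal (?u t * ?v t) \<partial>lborel) \<le> ennreal (A * 1)"
      proof (rule nn_integral_Holder[OF p q])
        have "J x \<le> ennreal (j + e)" using real that by (auto intro: ennreal_leI)
        then show "(\<integral>\<^sup>+t. ennreal (?u t powr p) \<partial>lborel) \<le> ennreal (A powr p)"
          unfolding u A(2) by (simp add: J_def ennreal_mult'' ennreal_indicator)
        show "(\<integral>\<^sup>+t. ennreal (?v t powr q) \<partial>lborel) \<le> ennreal (1 powr q)"
          unfolding v using \<phi> by (simp add: ennreal_mult'' ennreal_indicator)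
      qed (use A in auto)
      then have "ennreal (cmod (r x)) \<le> ennreal A"
        unfolding uv using r[of x] order_trans
        by (fastforce simp: ennreal_mult'' ennreal_indicator)
      then have "cmod (r x) powr p \<le> A powr p"
        using A p by (intro powr_mono2) auto
      then show ?thesis using A by simp
    qed
    then have "cmod (r x) powr p \<le> j" by (rule field_le_epsilon)
    then show ?thesis using real by (simp add: ennreal_leI)
  qed simp
  have "(\<integral>\<^sup>+x\<in>{-pi..pi}. ennreal (cmod (r x) powr p) \<partial>lborel) \<le> (\<integral>\<^sup>+x\<in>{-pi..pi}. J x \<partial>lborel)"
    by (intro nn_integral_mono mult_right_mono Jensen) auto
  also have "\<dots> = (\<integral>\<^sup>+x. \<integral>\<^sup>+t. ennreal (\<bar>\<phi> t\<bar> * cmod (\<Phi> (x - t)) powr p) * indicator {-pi..pi} t * indicator {-pi..pi} x \<partial>lborel \<partial>lborel)"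
    unfolding J_def by (intro nn_integral_cong, subst nn_integral_multc) auto
  also have "\<dots> = (\<integral>\<^sup>+t. \<integral>\<^sup>+x. ennreal (\<bar>\<phi> t\<bar> * cmod (\<Phi> (x - t)) powr p) * indicator {-pi..pi} t * indicator {-pi..pi} x \<partial>lborel \<partial>lborel)"
    by (rule lborel_pair.Fubini'[symmetric]) measurable
  also have "\<dots> = (\<integral>\<^sup>+t\<in>{-pi..pi}. ennreal \<bar>\<phi> t\<bar> * (\<integral>\<^sup>+x\<in>{-pi..pi}. ennreal (cmod (\<Phi> (x - t)) powr p) \<partial>lborel) \<partial>lborel)"
    by (intro nn_integral_cong)
       (simp add: ennreal_mult' nn_integral_cmult[symmetric] ac_simps)
  also have "\<dots> = (\<integral>\<^sup>+t\<in>{-pi..pi}. ennreal \<bar>\<phi> t\<bar> * (\<integral>\<^sup>+x\<in>{-pi..pi}. ennreal (cmod (\<Phi> x) powr p) \<partial>lborel) \<partial>lborel)"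
  proof (intro nn_integral_cong)
    fix t
    show "ennreal \<bar>\<phi> t\<bar> * (\<integral>\<^sup>+x\<in>{-pi..pi}. ennreal (cmod (\<Phi> (x - t)) powr p) \<partial>lborel) * indicator {-pi..pi} t
       = ennreal \<bar>\<phi> t\<bar> * (\<integral>\<^sup>+x\<in>{-pi..pi}. ennreal (cmod (\<Phi> x) powr p) \<partial>lborel) * indicator {-pi..pi} t"
      using nn_integral_period_reflect[of "\<lambda>x. ennreal (cmod (\<Phi> x) powr p)" t] per
      by (cases "\<bar>t\<bar> \<le> pi") (auto simp: periodic2pi_def indicator_def)
  qed
  also have "\<dots> = (\<integral>\<^sup>+t\<in>{-pi..pi}. ennreal \<bar>\<phi> t\<bar> \<partial>lborel) * (\<integral>\<^sup>+x\<in>{-pi..pi}. ennreal (cmod (\<Phi> x) powr p) \<partial>lborel)"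
    by (simp add: nn_integral_multc[symmetric] ac_simps)
  also have "\<dots> \<le> 1 * (\<integral>\<^sup>+x\<in>{-pi..pi}. ennreal (cmod (\<Phi> x) powr p) \<partial>lborel)"
    by (intro mult_right_mono \<phi>) auto
  finally show ?thesis by simp
qed

section \<open>Trigonometric sums with monotone coefficients\<close>

text \<open>Jordan's inequality: concavity keeps the sine above its chord over [0, pi/2].\<close>

lemma sin_ge_chord:
  assumes "0 \<le> y" "y \<le> pi / 2"
  shows "2 * y / pi \<le> sin y"
proof -
  have "convex_on {0..pi/2} (\<lambda>x. - sin x)"
    by (rule f''_ge0_imp_convex[where f' = "\<lambda>x. - cos x" and f'' = "sin"])
       (auto intro!: derivative_eq_intros sin_ge_zero)
  from convex_onD[OF this, of "2 * y / pi" 0 "pi/2"] assms show ?thesis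
    by (simp add: field_simps)
qed

lemma abs_le_cmod_one_minus_cis:
  assumes "\<bar>x\<bar> \<le> pi"
  shows "2 * \<bar>x\<bar> / pi \<le> cmod (1 - cis x)"
proof -
  have "cis x = cis (x/2) * cis (x/2)" by (simp add: cis_mult)
  then have "1 - cis x = cis (x/2) * (cis (-(x/2)) - cis (x/2))"
    by (simp add: ring_distribs cis_mult)
  also have "cis (-(x/2)) - cis (x/2) = - 2 * \<i> * of_real (sin (x/2))"
    by (simp add: complex_eq_iff)
  finally have "cmod (1 - cis x) = 2 * \<bar>sin (x/2)\<bar>"
    by (simp add: norm_mult)
  moreover have "2 * (\<bar>x\<bar>/2) / pi \<le> \<bar>sin (x/2)\<bar>"
    using sin_ge_chord[of "\<bar>x\<bar>/2"] assms by (cases "x \<ge> 0") auto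
  ultimately show ?thesis by simp
qed

text \<open>A geometric sum is at most 2 / |1 - cis x|, and the chord bound makes this at most pi /
  |x|. The factor |x| stands on the left so that x = 0 is included.\<close>

lemma cmod_sum_cis_le:
  assumes "\<bar>x\<bar> \<le> pi"
  shows "\<bar>x\<bar> * cmod (\<Sum>j<m. cis (of_nat j * x)) \<le> pi"
proof (cases "cis x = 1")
  case True
  then have "x = 0" using abs_le_cmod_one_minus_cis[OF assms] by (auto simp: field_simps)
  then show ?thesis by simp
next
  case False
  have "cis (of_nat j * x) = cis x ^ j" for j by (simp only: Complex.DeMoivre)
  then have "(\<Sum>j<m. cis (of_nat j * x)) = (1 - cis x ^ m) / (1 - cis x)"
    using False by (simp add: sum_gp_strict)
  moreover have "cmod (1 - cis x ^ m) \<le> 2"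
    using norm_triangle_ineq4[of 1 "cis x ^ m"] by (simp add: norm_power)
  moreover have p: "cmod (1 - cis x) > 0" using False by simp
  ultimately have "\<bar>x\<bar> * cmod (\<Sum>j<m. cis (of_nat j * x)) \<le> \<bar>x\<bar> * (2 / cmod (1 - cis x))"
    by (intro mult_left_mono) (auto simp: norm_divide divide_right_mono)
  also have "\<dots> \<le> pi"
    using abs_le_cmod_one_minus_cis[OF assms] p by (simp add: field_simps)
  finally show ?thesis .
qed

text \<open>After summation by parts the partial sums of z carry the weights c j - c (j + 1) and the
  last c. These are nonnegative and telescope to c 0.\<close>

lemma Abel_summation_bound:
  fixes c :: "nat \<Rightarrow> real" and z :: "nat \<Rightarrow> complex"
  assumes anti: "\<And>j. Suc j < m \<Longrightarrow> c (Suc j) \<le> c j" and nn: "\<And>j. j < m \<Longrightarrow> 0 \<le> c j"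
    and c0: "0 \<le> c 0" and D: "\<And>i. i \<le> m \<Longrightarrow> cmod (\<Sum>j<i. z j) \<le> D"
  shows "cmod (\<Sum>j<m. of_real (c j) * z j) \<le> c 0 * D"
proof (cases m)
  case 0
  then show ?thesis using c0 D[of 0] by simp
next
  case (Suc m')
  have eq: "(\<Sum>j<Suc k. of_real (c j) * z j) = of_real (c k) * (\<Sum>j<Suc k. z j)
      + (\<Sum>j<k. of_real (c j - c (Suc j)) * (\<Sum>i<Suc j. z i))" for k
    by (induction k) (simp_all add: algebra_simps)
  have tel: "c k + (\<Sum>j<k. c j - c (Suc j)) = c 0" for k
    by (induction k) auto
  have "cmod (\<Sum>j<m. of_real (c j) * z j)
    \<le> c m' * D + (\<Sum>j<m'. (c j - c (Suc j)) * D)"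
    unfolding Suc eq
  proof (rule norm_triangle_le[OF add_mono])
    show "cmod (of_real (c m') * (\<Sum>j<Suc m'. z j)) \<le> c m' * D"
      using nn[of m'] D[of "Suc m'"] Suc by (auto simp: norm_mult intro!: mult_left_mono simp del: sum.lessThan_Suc)
    show "cmod (\<Sum>j<m'. of_real (c j - c (Suc j)) * (\<Sum>i<Suc j. z i)) \<le> (\<Sum>j<m'. (c j - c (Suc j)) * D)"
    proof (rule sum_norm_le)
      fix j assume "j \<in> {..<m'}"
      then have "\<bar>c j - c (Suc j)\<bar> = c j - c (Suc j)" "cmod (\<Sum>i<Suc j. z i) \<le> D" "c j - c (Suc j) \<ge> 0"
        using anti[of j] D[of "Suc j"] Suc by (auto simp del: sum.lessThan_Suc)
      then show "cmod (of_real (c j - c (Suc j)) * (\<Sum>i<Suc j. z i)) \<le> (c j - c (Suc j)) * D"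
        by (simp add: norm_mult mult_left_mono del: sum.lessThan_Suc of_real_diff)
    qed
  qed
  also have "\<dots> = c 0 * D"
    unfolding tel[of m', symmetric] by (simp add: sum_distrib_right ring_distribs)
  finally show ?thesis .
qed

lemma cmod_antimono_trig_sum_le:
  fixes c :: "nat \<Rightarrow> real"
  assumes anti: "\<And>j. Suc j < m \<Longrightarrow> c (Suc j) \<le> c j" and nn: "\<And>j. j < m \<Longrightarrow> 0 \<le> c j"
    and c0: "0 \<le> c 0" and x: "\<bar>x\<bar> \<le> pi"
  shows "\<bar>x\<bar> * cmod (\<Sum>j<m. of_real (c j) * cis (of_nat j * x)) \<le> c 0 * pi"
proof (cases "x = 0")
  case False
  have "cmod (\<Sum>j<m. of_real (c j) * cis (of_nat j * x)) \<le> c 0 * (pi / \<bar>x\<bar>)"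
    by (rule Abel_summation_bound)
       (use assms cmod_sum_cis_le[OF x] False in \<open>auto simp: field_simps\<close>)
  then show ?thesis using False by (simp add: field_simps)
qed (use c0 in auto)

section \<open>L_p norm of a kernel with a peak of width 1/L and 1/|x| decay\<close>

lemma nn_integral_powr_tail:
  fixes p L :: real
  assumes p: "p > 1" and L: "L > 0"
  shows "(\<integral>\<^sup>+x. ennreal (x powr (-p)) * indicator {1/L..} x \<partial>lborel) = ennreal (L powr (p - 1) / (p - 1))"
proof -
  have "(\<integral>\<^sup>+x. ennreal (x powr (-p)) * indicator {1/L..} x \<partial>lborel)
     = ennreal (0 - (- ((1/L) powr (1 - p) / (p - 1))))"
  proof (rule nn_integral_FTC_atLeast)
    show "((\<lambda>x. - (x powr (1 - p) / (p - 1))) has_real_derivative x powr (-p)) (at x)" if "1/L \<le> x" for x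
    proof -
      have "x > 0" using that L by (meson less_le_trans zero_less_divide_1_iff)
      then have "((\<lambda>x. x powr (1 - p)) has_real_derivative (1 - p) * x powr (1 - p - 1)) (at x)"
        by (rule has_real_derivative_powr)
      moreover have "- (1 / (p - 1)) * ((1 - p) * x powr (1 - p - 1)) = x powr - p"
      proof -
        have "- (1 / (p - 1)) * (1 - p) = 1" using p by (simp add: field_simps)
        then show ?thesis by (simp flip: mult.assoc)
      qed
      ultimately show ?thesis
        using DERIV_cmult[of "\<lambda>x. x powr (1 - p)" "(1 - p) * x powr (1 - p - 1)" x UNIV "- (1 / (p - 1))"]
        by simp
    qed
    have "((\<lambda>x::real. x powr (1 - p)) \<longlongrightarrow> 0) at_top"
      using tendsto_neg_powr[OF _ filterlim_ident] p by auto
    then show "((\<lambda>x. - (x powr (1 - p) / (p - 1))) \<longlongrightarrow> 0) at_top"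
      using tendsto_minus[OF tendsto_divide_zero] by fastforce
  qed auto
  also have "(1/L) powr (1 - p) = L powr (p - 1)"
    using L by (simp add: powr_divide powr_diff)
  finally show ?thesis by simp
qed

text \<open>The two bounds on |G| agree up to the factor pi at |x| = 1/L. Using the first inside and
  the second outside, both parts are of order \<open>A powr p * L powr (p - 1)\<close>; p > 1 makes
  the tail integrable.\<close>

lemma nn_integral_peak_bound:
  fixes G :: "real \<Rightarrow> complex" and A L p :: real
  assumes p: "p > 1" and A: "A \<ge> 0" and L: "L > 0" 
    and peak: "\<And>x. cmod (G x) \<le> A * L" and decay: "\<And>x. \<bar>x\<bar> \<le> pi \<Longrightarrow> \<bar>x\<bar> * cmod (G x) \<le> A * pi"
  shows "(\<integral>\<^sup>+x\<in>{-pi..pi}. ennreal (cmod (G x) powr p) \<partial>lborel)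
    \<le> ennreal ((2 + 2 * pi powr p / (p - 1)) * (A powr p * L powr (p - 1)))"
proof -
  let ?h = "\<lambda>x::real. ennreal (x powr (-p)) * indicator {1/L..} x"
  \<comment> \<open>The tails are taken over full half-lines and the pieces are added, so nothing
    has to be said about whether 1/L exceeds pi.\<close>
  have pw: "ennreal (cmod (G x) powr p) * indicator {-pi..pi} x
    \<le> ennreal (A powr p * L powr p) * indicator {-1/L..1/L} x
      + ennreal (A powr p * pi powr p) * (?h x + ?h (-x))" for x
  proof (cases "\<bar>x\<bar> \<le> pi")
    case x: True
    show ?thesis
    proof (cases "\<bar>x\<bar> \<le> 1/L")
      case True
      have "cmod (G x) powr p \<le> (A * L) powr p"
        using peak[of x] p by (intro powr_mono2) auto
      then have "ennreal (cmod (G x) powr p) \<le> ennreal (A powr p * L powr p)"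
        using A L by (simp add: powr_mult)
      moreover have "x \<in> {-1/L..1/L}" using True by auto
      ultimately show ?thesis using x
        by (auto simp: indicator_def intro: add_increasing2)
    next
      case False
      then have x0: "\<bar>x\<bar> > 1/L" "\<bar>x\<bar> > 0" using L by (auto simp: field_simps)
      then have "cmod (G x) \<le> A * pi * inverse \<bar>x\<bar>" using decay[OF x] by (simp add: field_simps)
      then have "cmod (G x) powr p \<le> (A * pi * inverse \<bar>x\<bar>) powr p"
        using p by (intro powr_mono2) auto
      also have "\<dots> = A powr p * pi powr p * \<bar>x\<bar> powr (-p)"
        using A x0 by (simp add: powr_mult powr_minus inverse_powr)
      finally have "ennreal (cmod (G x) powr p) \<le> ennreal (A powr p * pi powr p) * ennreal (\<bar>x\<bar> powr (-p))"
        by (simp add: ennreal_mult'[symmetric] ennreal_leI)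
      also have "ennreal (\<bar>x\<bar> powr (-p)) \<le> ?h x + ?h (-x)"
        using x0 by (cases "x \<ge> 0") (auto simp: indicator_def)
      finally have "ennreal (cmod (G x) powr p) \<le> ennreal (A powr p * pi powr p) * (?h x + ?h (-x))"
        by (simp add: mult_left_mono)
      then show ?thesis using x by (auto simp: indicator_def intro: add_increasing)
    qed
  qed (auto simp: indicator_def)
  have h: "(\<integral>\<^sup>+x. ?h x \<partial>lborel) = ennreal (L powr (p - 1) / (p - 1))"
    by (rule nn_integral_powr_tail[OF p L])
  have h': "(\<integral>\<^sup>+x. ?h (-x) \<partial>lborel) = ennreal (L powr (p - 1) / (p - 1))"
    using nn_integral_real_affine[of ?h "-1" 0] h by simp
  have "(\<integral>\<^sup>+x\<in>{-pi..pi}. ennreal (cmod (G x) powr p) \<partial>lborel)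
    \<le> (\<integral>\<^sup>+x. ennreal (A powr p * L powr p) * indicator {-1/L..1/L} x
      + ennreal (A powr p * pi powr p) * (?h x + ?h (-x)) \<partial>lborel)"
    by (intro nn_integral_mono pw)
  also have "\<dots> = ennreal (A powr p * L powr p) * ennreal (2/L)
      + ennreal (A powr p * pi powr p) * (ennreal (L powr (p - 1) / (p - 1)) + ennreal (L powr (p - 1) / (p - 1)))"
    using L by (simp add: nn_integral_add nn_integral_cmult h h')
  also have "\<dots> = ennreal (A powr p * L powr p * (2/L) + A powr p * pi powr p * (L powr (p - 1) / (p - 1) + L powr (p - 1) / (p - 1)))"
    using L p by (simp add: ennreal_mult'[symmetric] ennreal_plus[symmetric] del: ennreal_plus)
  also have "A powr p * L powr p * (2/L) + A powr p * pi powr p * (L powr (p - 1) / (p - 1) + L powr (p - 1) / (p - 1))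
     = (2 + 2 * pi powr p / (p - 1)) * (A powr p * L powr (p - 1))"
    using L by (simp add: powr_diff algebra_simps)
  finally show ?thesis .
qed

section \<open>Rapidly decaying multipliers\<close>

locale rapidly_decaying =
  fixes \<psi> \<psi>' :: "real \<Rightarrow> real"
  assumes psi_class: "\<psi> \<in> class_M_pp_inf"
    and psi_deriv: "\<forall>t\<ge>1. (\<psi> has_real_derivative \<psi>' t) (at t within {1..})"
    and alpha_mono: "mono_on {1..} (\<lambda>t. \<psi> t / \<bar>\<psi>' t\<bar>)"
begin

definition lam :: "real \<Rightarrow> real" where "lam t = eta \<psi> t - t"
text \<open>Since (ln psi)' = -1 / alpha, this is the local length over which psi falls by a factor
  e.\<close>

definition alpha :: "real \<Rightarrow> real" where "alpha t = \<psi> t / \<bar>\<psi>' t\<bar>"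

lemma psi_convex: "convex_on {1..} \<psi>" and psi_cont: "continuous_on {1..} \<psi>"
  and psi_pos: "t \<ge> 1 \<Longrightarrow> \<psi> t > 0" and psi_lim: "(\<psi> \<longlongrightarrow> 0) at_top"
  and mu_mono: "mono_on {1..} (mu \<psi>)" and mu_lim: "filterlim (mu \<psi>) at_top at_top"
  and lam_bound: "\<exists>K>0. \<forall>t\<ge>1. lam t \<ge> K"
  using psi_class by (auto simp: class_M_pp_inf_def class_M_plus_inf_def class_M_def lam_def)

section \<open>Consequences of convexity and decay\<close>

lemma psi_nonneg: "t \<ge> 1 \<Longrightarrow> \<psi> t \<ge> 0"
  using psi_pos by (auto intro: less_imp_le)

lemma psi_small: "e > 0 \<Longrightarrow> \<exists>c>b. \<psi> c < e"
  using eventually_conj[OF order_tendstoD(2)[OF psi_lim, of e] eventually_gt_at_top[of b]]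
  by (auto simp: eventually_at_top_linorder)

text \<open>If psi did not fall from a to b, a later point c with a smaller value would put (b, psi
  b) strictly above the chord from a to c, against convexity.\<close>

lemma psi_strict_anti:
  assumes "1 \<le> a" "a < b"
  shows "\<psi> b < \<psi> a"
proof (rule ccontr)
  assume "\<not> \<psi> b < \<psi> a"
  then have le: "\<psi> a \<le> \<psi> b" by simp
  obtain c where c: "c > b" "\<psi> c < \<psi> b" using psi_small[of "\<psi> b" b] psi_pos assms by auto
  define t where "t = (b - a) / (c - a)"
  have t: "0 < t" "t \<le> 1" using assms c by (auto simp: t_def)
  have "b = (1 - t) * a + t * c"
  proof -
    have "t * (c - a) = b - a" using assms c by (simp add: t_def)
    then show ?thesis by (simp add: algebra_simps)
  qed
  then have "\<psi> b \<le> (1 - t) * \<psi> a + t * \<psi> c"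
    using convex_onD[OF psi_convex, of t a c] t assms c by simp
  also have "\<dots> \<le> (1 - t) * \<psi> b + t * \<psi> c"
    using t le by (intro add_mono mult_left_mono) auto
  also have "\<dots> < (1 - t) * \<psi> b + t * \<psi> b" using t c by simp
  finally show False by (simp add: algebra_simps)
qed

lemma psi_anti: "1 \<le> a \<Longrightarrow> a \<le> b \<Longrightarrow> \<psi> b \<le> \<psi> a"
  using psi_strict_anti[of a b] by (cases "a = b") auto

text \<open>The intermediate value theorem gives a point where psi has halved and strict
  monotonicity makes it unique, so the definite description in \<open>eta\<close> denotes
  it.\<close>

lemma eta_props:
  assumes t: "t \<ge> 1"
  shows "eta \<psi> t > t" "\<psi> (eta \<psi> t) = \<psi> t / 2"
proof -
  obtain c where c: "c > t" "\<psi> c < \<psi> t / 2" using psi_small[of "\<psi> t / 2" t] psi_pos t by auto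
  have "continuous_on {t..c} \<psi>" by (rule continuous_on_subset[OF psi_cont]) (use t in auto)
  then obtain u where u: "t \<le> u" "u \<le> c" "\<psi> u = \<psi> t / 2"
    using IVT2'[of \<psi> c "\<psi> t / 2" t] c psi_pos[OF t] by auto
  have "v = u" if "v \<ge> 1" "\<psi> v = \<psi> t / 2" for v
    using psi_strict_anti[of u v] psi_strict_anti[of v u] that u t by (cases u v rule: linorder_cases) auto
  then have "eta \<psi> t = u" unfolding eta_def using u t by (intro the_equality) auto
  moreover have "u \<noteq> t" using u psi_pos[OF t] by auto
  ultimately show "eta \<psi> t > t" "\<psi> (eta \<psi> t) = \<psi> t / 2" using u by auto
qed

lemma lam_pos: "t \<ge> 1 \<Longrightarrow> lam t > 0"
  using eta_props by (simp add: lam_def)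

lemma lam_nonneg: "t \<ge> 1 \<Longrightarrow> lam t \<ge> 0"
  using lam_pos by (auto intro: less_imp_le)

text \<open>By convexity every difference quotient on (t, t + 1) is at most the slope of the chord
  to t + 1, which is negative. This excludes division by zero in \<open>alpha\<close>.\<close>

lemma psi'_neg:
  assumes t: "t \<ge> 1"
  shows "\<psi>' t < 0"
proof -
  define d where "d = \<psi> (t + 1) - \<psi> t"
  have d: "d < 0" using psi_strict_anti[of t "t+1"] t by (simp add: d_def)
  have "(\<psi> has_real_derivative \<psi>' t) (at t within {t..})"
    using psi_deriv t by (auto intro: has_field_derivative_subset)
  then have "((\<lambda>y. (\<psi> y - \<psi> t) / (y - t)) \<longlongrightarrow> \<psi>' t) (at t within {t..})"
    by (simp add: has_field_derivative_iff)
  then have "((\<lambda>y. (\<psi> y - \<psi> t) / (y - t)) \<longlongrightarrow> \<psi>' t) (at_right t)"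
    by (rule tendsto_within_subset) auto
  moreover have "\<forall>\<^sub>F y in at_right t. (\<psi> y - \<psi> t) / (y - t) \<le> d"
  proof -
    have "\<forall>\<^sub>F y in at_right t. y \<in> {t<..<t+1}"
      using eventually_at_right_real[of t "t+1"] by simp
    then show ?thesis
    proof eventually_elim
      case (elim y)
      have "y = (1 - (y - t)) * t + (y - t) * (t + 1)" by (simp add: algebra_simps)
      then have "\<psi> y \<le> (1 - (y - t)) * \<psi> t + (y - t) * \<psi> (t + 1)"
        using convex_onD[OF psi_convex, of "y - t" t "t+1"] elim t by simp
      then have "\<psi> y - \<psi> t \<le> d * (y - t)" by (simp add: d_def algebra_simps)
      then show ?case using elim by (simp add: pos_divide_le_eq)
    qed
  qed
  ultimately have "\<psi>' t \<le> d"
    by (rule tendsto_upperbound) auto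
  then show ?thesis using d by simp
qed

section \<open>Exponential control of psi and comparison of the scales alpha and lam\<close>

lemma alpha_pos: "t \<ge> 1 \<Longrightarrow> alpha t > 0"
  unfolding alpha_def using psi_pos[of t] psi'_neg[of t] by (intro divide_pos_pos) auto

lemma alpha_le: "1 \<le> a \<Longrightarrow> a \<le> b \<Longrightarrow> alpha a \<le> alpha b"
  using alpha_mono by (auto simp: mono_on_def alpha_def)

text \<open>The mean value theorem for ln psi gives the exact rate 1 / alpha z at some z between a
  and b, and alpha z lies between alpha a and alpha b.\<close>

lemma psi_ratio:
  assumes a: "1 \<le> a" and ab: "a \<le> b"
  shows "\<psi> a / \<psi> b \<le> exp ((b - a) / alpha a)" "exp ((b - a) / alpha b) \<le> \<psi> a / \<psi> b"
proof -
  have "\<psi> a / \<psi> b \<le> exp ((b - a) / alpha a) \<and> exp ((b - a) / alpha b) \<le> \<psi> a / \<psi> b"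
  proof (cases "a = b")
    case True
    then show ?thesis using psi_pos[of b] a by simp
  next
    case False
    then have lt: "a < b" using ab by simp
    have D: "((\<lambda>t. ln (\<psi> t)) has_real_derivative - 1 / alpha x) (at x)" if "a < x" for x
    proof -
      have x: "x > 1" using that a by simp
      \<comment> \<open>Only interior points enter the mean value theorem, and there the derivative
        relative to \<open>{1..}\<close> is the ordinary one.\<close>
      then have "at x within {1..} = at x" by (intro at_within_interior) auto
      then have "(\<psi> has_real_derivative \<psi>' x) (at x)" using psi_deriv x by (metis less_imp_le)
      then show ?thesis using psi_pos[of x] psi'_neg[of x] x
        by (auto intro!: derivative_eq_intros simp: alpha_def)
    qed
    have "continuous_on {a..b} (\<lambda>t. ln (\<psi> t))"
    proof (intro continuous_intros continuous_on_subset[OF psi_cont])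
      show "\<forall>t\<in>{a..b}. \<psi> t \<noteq> 0"
      proof
        fix t assume "t \<in> {a..b}"
        then show "\<psi> t \<noteq> 0" using psi_pos[of t] a by simp
      qed
    qed (use a in auto)
    from MVT[OF lt this] obtain l z where z: "a < z" "z < b" "DERIV (\<lambda>t. ln (\<psi> t)) z :> l"
      "ln (\<psi> b) - ln (\<psi> a) = (b - a) * l"
      using D real_differentiable_def by blast
    then have "l = - 1 / alpha z" using DERIV_unique D by blast
    then have eq: "ln (\<psi> a) - ln (\<psi> b) = (b - a) / alpha z" using z by (simp add: field_simps)
    have p: "\<psi> a > 0" "\<psi> b > 0" "alpha a > 0" using psi_pos alpha_pos a ab by auto
    have r: "\<psi> a / \<psi> b = exp ((b - a) / alpha z)"
      using p by (simp add: eq[symmetric] exp_diff)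
    have al: "alpha a \<le> alpha z" "alpha z \<le> alpha b" using z a by (auto intro: alpha_le)
    have "(b - a) / alpha z \<le> (b - a) / alpha a" "(b - a) / alpha b \<le> (b - a) / alpha z"
      using al p lt by (auto intro!: divide_left_mono mult_pos_pos)
    then show ?thesis unfolding r by simp
  qed
  then show "\<psi> a / \<psi> b \<le> exp ((b - a) / alpha a)" "exp ((b - a) / alpha b) \<le> \<psi> a / \<psi> b" by auto
qed

text \<open>Beyond t the logarithmic decay rate is at most 1 / alpha t, so a drop by the factor 2
  needs a distance of at least alpha t ln 2.\<close>

lemma alpha_le_lam:
  assumes t: "t \<ge> 1"
  shows "alpha t * ln 2 \<le> lam t"
proof -
  have "2 \<le> exp (lam t / alpha t)"
    using psi_ratio(1)[of t "eta \<psi> t"] eta_props[OF t] t psi_pos[OF t] by (simp add: lam_def)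
  then have "ln 2 \<le> lam t / alpha t" by (metis exp_gt_zero ln_exp ln_le_cancel_iff zero_less_numeral)
  then show ?thesis using alpha_pos[OF t] by (simp add: field_simps)
qed

text \<open>With mu = t / lam, monotonicity of mu bounds lam (eta t) / lam t by eta t / t, which
  equals 1 + 1 / mu t.\<close>

lemma lam_eta_le:
  assumes t: "t \<ge> 1"
  shows "lam (eta \<psi> t) \<le> lam t * (1 + 1 / mu \<psi> t)"
proof -
  let ?e = "eta \<psi> t"
  have e: "?e > t" "?e \<ge> 1" using eta_props[OF t] t by auto
  have l: "lam t > 0" "lam ?e > 0" using lam_pos e t by auto
  have mu: "mu \<psi> t = t / lam t" "mu \<psi> ?e = ?e / lam ?e" by (auto simp: mu_def lam_def)
  have "t / lam t \<le> ?e / lam ?e" using monotone_onD[OF mu_mono, of t ?e] e t by (simp add: mu)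
  then have "lam ?e \<le> ?e * lam t / t" using l t e by (simp add: field_simps)
  also have "?e * lam t / t = (t + lam t) * lam t / t" by (simp add: lam_def)
  finally have "lam ?e \<le> (t + lam t) * lam t / t" .
  also have "\<dots> = lam t * (1 + 1 / mu \<psi> t)" using l t unfolding mu by (simp add: field_simps)
  finally show ?thesis .
qed

text \<open>One block \<open>[t, eta t)\<close> contributes at most \<open>(lam t + 1) * psi t\<close>; passing to \<open>eta t\<close> halves
  \<open>psi\<close> and multiplies \<open>lam\<close> by at most 4/3, so the blocks form a geometric series.\<close>
lemma tail_sum_large:
  assumes K: "K > 0" "\<And>t. t \<ge> 1 \<Longrightarrow> lam t \<ge> K" and t: "t \<ge> 1" "\<And>u. u \<ge> t \<Longrightarrow> mu \<psi> u \<ge> 3"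
  shows "(\<Sum>j<m. \<psi> (t + real j)) \<le> 3 * (1 + 1 / K) * \<psi> t * lam t"
  using t
\<comment> \<open>The starting point t is real because the next block begins at
  \<open>eta \<psi> t\<close>, in general not an integer.\<close>
proof (induction m arbitrary: t rule: less_induct)
  case (less m)
  \<comment> \<open>The factor 1 + 1/K turns lam t + 1 into a multiple of lam t. The first block
    takes a third of the bound; the induction hypothesis at \<open>eta \<psi> t\<close> takes 1/2
    times 4/3, the other two thirds.\<close>
  define C where "C = 3 * (1 + 1 / K)"
  have C0: "C > 0" using K by (simp add: C_def add_pos_pos)
  have e: "eta \<psi> t > t" "\<psi> (eta \<psi> t) = \<psi> t / 2" using eta_props less.prems by auto
  have l: "lam t > 0" "lam t \<ge> K" "\<psi> t > 0" using lam_pos K less.prems psi_pos by auto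
  \<comment> \<open>Rounding up ensures that t + p has passed \<open>eta \<psi> t\<close>; p > 0
    makes the remaining sum shorter, so the induction applies.\<close>
  define p where "p = nat \<lceil>lam t\<rceil>"
  have p: "real p \<ge> lam t" "real p \<le> lam t + 1" "p > 0" using l unfolding p_def by linarith+
  have "lam t + 1 \<le> C / 3 * lam t"
  proof -
    have "1 \<le> lam t / K" using l K by simp
    then show ?thesis by (simp add: C_def ring_distribs)
  qed
  then have block: "real p * \<psi> t \<le> C / 3 * \<psi> t * lam t"
    using p l mult_right_mono[of "real p" "C / 3 * lam t" "\<psi> t"] by (simp add: ac_simps)
  have b1: "(\<Sum>j<q. \<psi> (t + real j)) \<le> real q * \<psi> t" for q
    using sum_bounded_above[of "{..<q}" "\<lambda>j. \<psi> (t + real j)" "\<psi> t"] psi_anti[of t] less.prems by simp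
  show ?case
  proof (cases "m \<le> p")
    case True
    have "(\<Sum>j<m. \<psi> (t + real j)) \<le> real m * \<psi> t" by (rule b1)
    also have "\<dots> \<le> real p * \<psi> t" using True l by (intro mult_right_mono) auto
    also have "\<dots> \<le> C / 3 * (\<psi> t * lam t)" using block by simp
    also have "\<dots> \<le> C * (\<psi> t * lam t)" using C0 l by (intro mult_right_mono) auto
    finally show ?thesis by (simp add: C_def mult.assoc)
  next
    case False
    let ?e = "eta \<psi> t"
    have "(\<Sum>j<m. \<psi> (t + real j)) = (\<Sum>j<p. \<psi> (t + real j)) + (\<Sum>j<m - p. \<psi> (t + real (p + j)))"
      using sum.atLeastLessThan_concat[of 0 p m "\<lambda>j. \<psi> (t + real j)"] False
        sum.shift_bounds_nat_ivl[of "\<lambda>j. \<psi> (t + real j)" 0 p "m - p"]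
      by (simp add: atLeast0LessThan add.commute)
    also have "(\<Sum>j<m - p. \<psi> (t + real (p + j))) \<le> (\<Sum>j<m - p. \<psi> (?e + real j))"
      using p e less.prems by (intro sum_mono psi_anti) (auto simp: lam_def)
    also have "\<dots> \<le> C * \<psi> ?e * lam ?e"
      unfolding C_def using False p(3) e(1) less.prems by (intro less.IH) auto
    also have "\<dots> \<le> C * (\<psi> t / 2) * (lam t * (4 / 3))"
    proof -
      have "mu \<psi> t \<ge> 3" using less.prems by auto
      then have "1 / mu \<psi> t \<le> 1 / 3" by (intro divide_left_mono) auto
      then have "lam t * (1 + 1 / mu \<psi> t) \<le> lam t * (4 / 3)" using l by (intro mult_left_mono) auto
      with lam_eta_le[OF less.prems(1)] have "lam ?e \<le> lam t * (4 / 3)" by (rule order_trans)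
      then show ?thesis unfolding e(2) using C0 l by (intro mult_left_mono) auto
    qed
    also have "(\<Sum>j<p. \<psi> (t + real j)) \<le> C / 3 * \<psi> t * lam t"
      using b1[of p] block by simp
    finally show ?thesis unfolding C_def[symmetric] by (simp add: field_simps)
  qed
qed

text \<open>For large n, mu is at least 3 and the block argument applies. The finitely many smaller
  n share one bound B on their tails.\<close>

lemma tail_sum:
  "\<exists>C>0. \<forall>n\<ge>1. \<forall>m. (\<Sum>j<m. \<psi> (real n + real j)) \<le> C * \<psi> (real n) * lam (real n)"
proof -
  obtain K where K: "K > 0" "\<And>t. t \<ge> 1 \<Longrightarrow> lam t \<ge> K" using lam_bound by blast
  obtain T where T: "\<And>t. t \<ge> T \<Longrightarrow> mu \<psi> t \<ge> 3"
    using mu_lim by (auto simp: filterlim_at_top eventually_at_top_linorder)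
  define N where "N = nat \<lceil>max 1 T\<rceil>"
  have N: "real N \<ge> 1" "real N \<ge> T" unfolding N_def by linarith+
  define C where "C = 3 * (1 + 1 / K)"
  have C0: "C > 0" using K by (simp add: C_def add_pos_pos)
  have big: "(\<Sum>j<m. \<psi> (real n + real j)) \<le> C * \<psi> (real n) * lam (real n)" if "n \<ge> N" for n m
    unfolding C_def by (rule tail_sum_large[OF K]) (use that N T in auto)
  define B where "B = real N * \<psi> 1 + C * \<psi> (real N) * lam (real N)"
  have pN: "\<psi> (real N) > 0" "lam (real N) > 0" "\<psi> 1 > 0" using psi_pos lam_pos N by auto
  have B0: "B > 0" unfolding B_def using pN C0 N by (intro add_pos_pos mult_pos_pos) auto
  have small: "(\<Sum>j<m. \<psi> (real n + real j)) \<le> B" if n: "n \<ge> 1" "n < N" for n m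
  proof -
    have "(\<Sum>j<m. \<psi> (real n + real j)) = (\<Sum>k=n..<n+m. \<psi> (real k))"
      using sum.shift_bounds_nat_ivl[of "\<lambda>j. \<psi> (real j)" 0 n m] by (simp add: atLeast0LessThan add.commute)
    also have "\<dots> \<le> (\<Sum>k\<in>{1..<N} \<union> {N..<N+m}. \<psi> (real k))"
      using n N by (intro sum_mono2) (auto intro!: psi_nonneg)
    also have "\<dots> = (\<Sum>k\<in>{1..<N}. \<psi> (real k)) + (\<Sum>k\<in>{N..<N+m}. \<psi> (real k))"
      by (intro sum.union_disjoint) auto
    also have "(\<Sum>k\<in>{N..<N+m}. \<psi> (real k)) = (\<Sum>j<m. \<psi> (real N + real j))"
      using sum.shift_bounds_nat_ivl[of "\<lambda>j. \<psi> (real j)" 0 N m] by (simp add: atLeast0LessThan add.commute)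
    also have "\<dots> \<le> C * \<psi> (real N) * lam (real N)" by (rule big) simp
    also have "(\<Sum>k\<in>{1..<N}. \<psi> (real k)) \<le> real (card {1..<N}) * \<psi> 1"
      by (rule sum_bounded_above) (auto intro: psi_anti)
    also have "\<dots> \<le> real N * \<psi> 1" using pN by (intro mult_right_mono) auto
    finally show ?thesis by (simp add: B_def)
  qed
  \<comment> \<open>For n < N the product psi(n) lam(n) is at least psi(N) K, so this multiple of it
    dominates B.\<close>
  define C' where "C' = B / (\<psi> (real N) * K)"
  have C': "C' > 0" unfolding C'_def using B0 pN K by auto
  have "(\<Sum>j<m. \<psi> (real n + real j)) \<le> (C + C') * \<psi> (real n) * lam (real n)" if n: "n \<ge> 1" for n m
  proof (cases "n < N")
    case True
    have "B = C' * \<psi> (real N) * K" using pN K by (simp add: C'_def)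
    also have "\<dots> \<le> C' * \<psi> (real n) * lam (real n)"
      using C' pN K n True psi_anti[of "real n" "real N"]
      by (intro mult_mono) (auto intro!: mult_nonneg_nonneg psi_nonneg)
    also have "\<dots> \<le> (C + C') * \<psi> (real n) * lam (real n)"
      using C0 n by (intro mult_right_mono) (auto intro!: psi_nonneg lam_nonneg)
    finally show ?thesis using small[OF n True, of m] by simp
  next
    case False
    then have "(\<Sum>j<m. \<psi> (real n + real j)) \<le> C * \<psi> (real n) * lam (real n)" by (intro big) simp
    also have "\<dots> \<le> (C + C') * \<psi> (real n) * lam (real n)"
      using C' n by (intro mult_right_mono) (auto intro!: psi_nonneg lam_nonneg)
    finally show ?thesis .
  qed
  then show ?thesis using C0 C' by (intro exI[of _ "C + C'"]) auto
qed

text \<open>Below n the decay rate is at least 1 / alpha(n), so the ratios are dominated by powers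
  of exp(-1 / alpha(n)). The geometric series is at most 1 + alpha(n) because exp(x) is at least 1 +
  x.\<close>

lemma head_sum_le:
  assumes n: "n \<ge> 1"
  shows "(\<Sum>k=1..n. \<psi> (real n) / \<psi> (real k)) \<le> 1 + alpha (real n)"
proof -
  let ?q = "exp (- (1 / alpha (real n)))"
  have a: "alpha (real n) > 0" using alpha_pos n by auto
  have "?q < 1" using a by simp
  have "(\<Sum>k=1..n. \<psi> (real n) / \<psi> (real k)) \<le> (\<Sum>k=1..n. ?q ^ (n - k))"
  proof (rule sum_mono)
    fix k assume k: "k \<in> {1..n}"
    have "exp ((real n - real k) / alpha (real n)) \<le> \<psi> (real k) / \<psi> (real n)"
      using psi_ratio(2)[of "real k" "real n"] k by auto
    then have "inverse (\<psi> (real k) / \<psi> (real n)) \<le> inverse (exp ((real n - real k) / alpha (real n)))"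
      by (rule le_imp_inverse_le) simp
    also have "\<dots> = ?q ^ (n - k)"
      using k by (simp flip: exp_of_nat_mult exp_minus add: of_nat_diff)
    finally show "\<psi> (real n) / \<psi> (real k) \<le> ?q ^ (n - k)" by simp
  qed
  also have "\<dots> = (\<Sum>j<n. ?q ^ j)"
    by (rule sum.reindex_bij_witness[of _ "\<lambda>j. n - j" "\<lambda>k. n - k"]) auto
  also have "\<dots> = (1 - ?q ^ n) / (1 - ?q)" using \<open>?q < 1\<close> by (simp add: sum_gp_strict)
  also have "\<dots> \<le> 1 / (1 - ?q)" using \<open>?q < 1\<close> by (intro divide_right_mono) auto
  also have "\<dots> \<le> 1 + alpha (real n)"
  proof -
    have "1 + 1 / alpha (real n) \<le> exp (1 / alpha (real n))" by (rule exp_ge_add_one_self)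
    then have "?q \<le> inverse (1 + 1 / alpha (real n))"
      unfolding exp_minus using a by (intro le_imp_inverse_le) (auto simp: add_pos_pos)
    also have "\<dots> = 1 - 1 / (1 + alpha (real n))" using a by (simp add: field_simps)
    finally have "1 / (1 + alpha (real n)) \<le> 1 - ?q" by simp
    then show ?thesis using a \<open>?q < 1\<close> by (simp add: field_simps)
  qed
  finally show ?thesis .
qed

text \<open>The factor 2 is the drop up to \<open>eta\<close>; the overshoot of at most 1 costs at
  most exp(1 / alpha 1), since alpha is smallest at 1.\<close>

lemma psi_ratio_ceiling:
  assumes n: "n \<ge> 1" and M: "real M > eta \<psi> (real n)" "real M \<le> eta \<psi> (real n) + 1"
  shows "\<psi> (real n) / \<psi> (real M) \<le> 2 * exp (1 / alpha 1)"
proof -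
  let ?e = "eta \<psi> (real n)"
  have e: "?e > real n" "\<psi> ?e = \<psi> (real n) / 2" using eta_props[of "real n"] n by auto
  have "\<psi> ?e / \<psi> (real M) \<le> exp ((real M - ?e) / alpha ?e)"
    using n M e by (intro psi_ratio(1)) auto
  also have "(real M - ?e) / alpha ?e \<le> 1 / alpha 1"
    using M e n alpha_pos[of 1] alpha_le[of 1 ?e] by (intro frac_le) auto
  finally show ?thesis using e by simp
qed

lemma ratio_sum:
  "\<exists>C>0. \<forall>n\<ge>1. \<forall>M. real M > eta \<psi> (real n) \<longrightarrow> real M \<le> eta \<psi> (real n) + 1 \<longrightarrow>
    (\<Sum>k=1..M. \<psi> (real n) / \<psi> (real k)) \<le> C * lam (real n)"
proof -
  obtain K where K: "K > 0" "\<And>t. t \<ge> 1 \<Longrightarrow> lam t \<ge> K" using lam_bound by blast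
  define D where "D = 2 * exp (1 / alpha 1)"
  \<comment> \<open>The first two terms absorb 1 + alpha(n) from k up to n; the last counts at most
    lam(n) + 1 terms beyond n, each at most D.\<close>
  define C where "C = 1 / K + 1 / ln 2 + D * (1 + 1 / K)"
  have D: "D > 0" by (simp add: D_def)
  have C: "C > 0" unfolding C_def using K D by (intro add_pos_pos mult_pos_pos) auto
  have "(\<Sum>k=1..M. \<psi> (real n) / \<psi> (real k)) \<le> C * lam (real n)"
    if n: "n \<ge> 1" and M: "real M > eta \<psi> (real n)" "real M \<le> eta \<psi> (real n) + 1" for n M
  proof -
    have e: "eta \<psi> (real n) > real n" using eta_props n by auto
    then have nM: "n < M" using M by linarith
    have l: "lam (real n) \<ge> K" "lam (real n) > 0" "1 \<le> lam (real n) / K" using K n lam_pos by auto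
    have "(\<Sum>k=1..M. \<psi> (real n) / \<psi> (real k))
       = (\<Sum>k=1..n. \<psi> (real n) / \<psi> (real k)) + (\<Sum>k=n+1..M. \<psi> (real n) / \<psi> (real k))"
      using nM sum.ub_add_nat[of 1 n "\<lambda>k. \<psi> (real n) / \<psi> (real k)" "M - n"] by simp
    also have "(\<Sum>k=1..n. \<psi> (real n) / \<psi> (real k)) \<le> 1 + alpha (real n)" by (rule head_sum_le[OF n])
    also have "\<dots> \<le> lam (real n) / K + lam (real n) / ln 2"
      using l alpha_le_lam[of "real n"] n by (intro add_mono) (auto simp: pos_le_divide_eq)
    also have "(\<Sum>k=n+1..M. \<psi> (real n) / \<psi> (real k)) \<le> real (card {n+1..M}) * D"
    proof (rule sum_bounded_above)
      fix k assume k: "k \<in> {n+1..M}"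
      have "\<psi> (real n) / \<psi> (real k) \<le> \<psi> (real n) / \<psi> (real M)"
        using k n psi_pos[of "real M"] psi_pos[of "real n"] psi_pos[of "real k"]
        by (intro divide_left_mono psi_anti mult_pos_pos) auto
      then show "\<psi> (real n) / \<psi> (real k) \<le> D"
        using psi_ratio_ceiling[OF n M] by (simp add: D_def)
    qed
    also have "real (card {n+1..M}) \<le> lam (real n) + 1" using M nM by (simp add: lam_def of_nat_diff)
    also have "\<dots> \<le> lam (real n) * (1 + 1 / K)" using l by (simp add: ring_distribs)
    finally show ?thesis using D by (simp add: C_def ring_distribs mult.commute)
  qed
  then show ?thesis using C by blast
qed

end

section \<open>Upper bound\<close>

text \<open>The p-th root of the constant in \<open>nn_integral_peak_bound\<close>, for stating that
  estimate as a norm bound.\<close>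

definition peak_const :: "real \<Rightarrow> real" where
  "peak_const p = (2 + 2 * pi powr p / (p - 1)) powr (1 / p)"

lemma peak_const_pos: "p > 1 \<Longrightarrow> peak_const p > 0"
  by (simp add: peak_const_def) (smt (verit) divide_pos_pos pi_gt_zero powr_gt_zero)

lemma Lp_peak_bound:
  fixes G :: "real \<Rightarrow> complex" and A L p :: real
  assumes p: "p > 1" and A: "A \<ge> 0" and L: "L > 0"
    and peak: "\<And>x. cmod (G x) \<le> A * L" and decay: "\<And>x. \<bar>x\<bar> \<le> pi \<Longrightarrow> \<bar>x\<bar> * cmod (G x) \<le> A * pi"
  shows "(\<integral>\<^sup>+x\<in>{-pi..pi}. ennreal (cmod (G x) powr p) \<partial>lborel)
    \<le> ennreal ((peak_const p * A * L powr (1 - 1 / p)) powr p)"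
proof -
  have "0 \<le> 2 + 2 * pi powr p / (p - 1)" using p by simp
  moreover have "(1 - 1 / p) * p = p - 1" using p by (simp add: field_simps)
  ultimately have "(peak_const p * A * L powr (1 - 1 / p)) powr p = (2 + 2 * pi powr p / (p - 1)) * (A powr p * L powr (p - 1))"
    using p A by (simp add: peak_const_def powr_mult powr_powr)
  then show ?thesis using nn_integral_peak_bound[OF assms] by simp
qed

section \<open>Fourier multipliers as convolutions\<close>

lemma in_Lp_1_set_integrable:
  assumes "in_Lp 1 f"
  shows "set_integrable lborel {-pi..pi} f"
proof -
  have [measurable]: "f \<in> borel_measurable borel" and per: "periodic2pi f"
    and fin: "Lp_norm 1 (\<lambda>x. complex_of_real (f x)) < \<infinity>"
    using assms by (auto simp: in_Lp_def)
  obtain B where B: "B \<ge> 0" "Lp_norm 1 (\<lambda>x. complex_of_real (f x)) \<le> ennreal B"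
    using fin by (cases "Lp_norm 1 (\<lambda>x. complex_of_real (f x))") auto
  then have "(\<integral>\<^sup>+x\<in>{-pi..pi}. ennreal (cmod (complex_of_real (f x)) powr 1) \<partial>lborel) \<le> ennreal (B powr 1)"
    using Lp_norm_le_iff[of "\<lambda>x. complex_of_real (f x)" 1 B] per by (auto simp: periodic2pi_def)
  then have le: "(\<integral>\<^sup>+x\<in>{-pi..pi}. ennreal \<bar>f x\<bar> \<partial>lborel) \<le> ennreal (B powr 1)" by simp
  have "(\<integral>\<^sup>+x. ennreal (norm (indicator {-pi..pi} x *\<^sub>R f x)) \<partial>lborel) = (\<integral>\<^sup>+x\<in>{-pi..pi}. ennreal \<bar>f x\<bar> \<partial>lborel)"
    by (intro nn_integral_cong) (auto simp: indicator_def)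
  then have "(\<integral>\<^sup>+x. ennreal (norm (indicator {-pi..pi} x *\<^sub>R f x)) \<partial>lborel) < \<infinity>"
    using le by (auto intro: le_less_trans)
  then show ?thesis unfolding set_integrable_def by (intro integrableI_bounded) auto
qed

lemma nn_integral_abs_le_1:
  assumes "in_Lp 1 \<phi>" "Lp_norm 1 (\<lambda>x. complex_of_real (\<phi> x)) \<le> 1"
  shows "(\<integral>\<^sup>+x\<in>{-pi..pi}. ennreal \<bar>\<phi> x\<bar> \<partial>lborel) \<le> 1"
  using Lp_norm_le_iff[of "\<lambda>x. complex_of_real (\<phi> x)" 1 1] assms
  by (auto simp: in_Lp_def periodic2pi_def)

lemma cis_periodic: "cis (real_of_int k * (x + 2 * pi)) = cis (real_of_int k * x)"
proof -
  have "cis (real_of_int k * (x + 2 * pi)) = cis (real_of_int k * x) * cis (2 * pi * real_of_int k)"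
    by (simp add: cis_mult ring_distribs ac_simps)
  also have "cis (2 * pi * real_of_int k) = 1" by (rule cis_multiple_2pi) simp
  finally show ?thesis by simp
qed

lemma trig_polynomial_periodic:
  "periodic2pi (\<lambda>x. \<Sum>k\<in>A. a k * cis (real_of_int k * x))"
  by (simp add: periodic2pi_def cis_periodic)

lemma norm_set_integral_le_nn:
  fixes F :: "real \<Rightarrow> complex"
  assumes "set_integrable lborel S F"
  shows "ennreal (cmod (LINT t:S|lborel. F t)) \<le> (\<integral>\<^sup>+t\<in>S. ennreal (cmod (F t)) \<partial>lborel)"
proof -
  have "ennreal (cmod (LINT t:S|lborel. F t)) \<le> (\<integral>\<^sup>+t. ennreal (cmod (indicator S t *\<^sub>R F t)) \<partial>lborel)"
    unfolding set_lebesgue_integral_def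
    by (rule integral_norm_bound_ennreal) (use assms in \<open>simp add: set_integrable_def\<close>)
  also have "\<dots> = (\<integral>\<^sup>+t\<in>S. ennreal (cmod (F t)) \<partial>lborel)"
    by (intro nn_integral_cong) (auto simp: indicator_def)
  finally show ?thesis .
qed

text \<open>The sum is the convolution of the function with the kernel of w, divided by 2 pi; that
  divisor exceeds 1 and is dropped.\<close>

lemma multiplier_convolution_le:
  fixes \<phi> :: "real \<Rightarrow> real" and w :: "int \<Rightarrow> complex"
  assumes A: "finite A" and \<phi>: "set_integrable lborel {-pi..pi} \<phi>"
    and [measurable]: "\<phi> \<in> borel_measurable borel"
  shows "ennreal (cmod (\<Sum>k\<in>A. w k * fourier_coeff \<phi> k * cis (real_of_int k * x)))
    \<le> (\<integral>\<^sup>+t\<in>{-pi..pi}. ennreal (\<bar>\<phi> t\<bar> * cmod (\<Sum>k\<in>A. w k * cis (real_of_int k * (x - t)))) \<partial>lborel)"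
proof -
  let ?\<Phi> = "\<lambda>y. \<Sum>k\<in>A. w k * cis (real_of_int k * y)"
  let ?\<phi> = "\<lambda>t. complex_of_real (\<phi> t)"
  have \<phi>c: "set_integrable lborel {-pi..pi} ?\<phi>"
    using \<phi> by (simp add: set_integrable_def flip: of_real_mult add: scaleR_conv_of_real)
  have i: "set_integrable lborel {-pi..pi} (\<lambda>t. w k * cis (real_of_int k * x) * (?\<phi> t * cis (- real_of_int k * t)))" for k
    by (intro set_integrable_mult_right set_integrable_mult_cis \<phi>c)
  have conv: "?\<phi> t * ?\<Phi> (x - t) = (\<Sum>k\<in>A. w k * cis (real_of_int k * x) * (?\<phi> t * cis (- real_of_int k * t)))" for t
  proof -
    have "cis (real_of_int k * (x - t)) = cis (real_of_int k * x) * cis (- real_of_int k * t)" for k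
      by (simp add: cis_mult right_diff_distrib)
    then show ?thesis by (simp only: sum_distrib_left ac_simps)
  qed
  have "(LINT t:{-pi..pi}|lborel. ?\<phi> t * ?\<Phi> (x - t))
    = (\<Sum>k\<in>A. LINT t:{-pi..pi}|lborel. w k * cis (real_of_int k * x) * (?\<phi> t * cis (- real_of_int k * t)))"
    unfolding conv set_lebesgue_integral_def scaleR_sum_right
    by (rule Bochner_Integration.integral_sum) (rule i[unfolded set_integrable_def])
  also have "\<dots> = (\<Sum>k\<in>A. w k * cis (real_of_int k * x) * (2 * complex_of_real pi * fourier_coeff \<phi> k))"
    using fourier_coeff_alt[of \<phi> "- k" for k] by (simp add: set_integral_mult_right)
  finally have eq: "(LINT t:{-pi..pi}|lborel. ?\<phi> t * ?\<Phi> (x - t))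
     = 2 * pi * (\<Sum>k\<in>A. w k * fourier_coeff \<phi> k * cis (real_of_int k * x))"
    by (simp add: sum_distrib_left ac_simps)
  let ?R = "\<Sum>k\<in>A. w k * fourier_coeff \<phi> k * cis (real_of_int k * x)"
  have "1 * cmod ?R \<le> 2 * pi * cmod ?R"
    using pi_ge_two by (intro mult_right_mono) auto
  also have "\<dots> = cmod (LINT t:{-pi..pi}|lborel. ?\<phi> t * ?\<Phi> (x - t))"
    unfolding eq by (simp add: norm_mult)
  finally have "ennreal (cmod ?R) \<le> ennreal (cmod (LINT t:{-pi..pi}|lborel. ?\<phi> t * ?\<Phi> (x - t)))"
    by (simp add: ennreal_leI)
  also have "\<dots> \<le> (\<integral>\<^sup>+t\<in>{-pi..pi}. ennreal (cmod (?\<phi> t * ?\<Phi> (x - t))) \<partial>lborel)"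
  proof (rule norm_set_integral_le_nn)
    show "set_integrable lborel {-pi..pi} (\<lambda>t. ?\<phi> t * ?\<Phi> (x - t))"
      unfolding conv set_integrable_def scaleR_sum_right
      by (rule Bochner_Integration.integrable_sum) (rule i[unfolded set_integrable_def])
  qed
  finally show ?thesis by (simp add: norm_mult)
qed

lemma cmod_fourier_coeff_le_1:
  assumes "in_Lp 1 \<phi>" "Lp_norm 1 (\<lambda>x. complex_of_real (\<phi> x)) \<le> 1"
  shows "cmod (fourier_coeff \<phi> k) \<le> 1"
proof -
  have "ennreal (cmod (\<Sum>k\<in>{k}. 1 * fourier_coeff \<phi> k * cis (real_of_int k * 0)))
    \<le> (\<integral>\<^sup>+t\<in>{-pi..pi}. ennreal (\<bar>\<phi> t\<bar> * cmod (\<Sum>k\<in>{k}. 1 * cis (real_of_int k * (0 - t)))) \<partial>lborel)"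
    by (rule multiplier_convolution_le)
       (use in_Lp_1_set_integrable[OF assms(1)] assms(1) in \<open>auto simp: in_Lp_def\<close>)
  also have "\<dots> \<le> 1" using nn_integral_abs_le_1[OF assms] by simp
  finally show ?thesis by simp
qed

context rapidly_decaying
begin

text \<open>The two choices of p allow removed blocks of 2n - 1 or of 2n frequencies. Both bounds
  are expressed through n, so that the choices share one estimate.\<close>

lemma one_sided_kernel_bounds:
  assumes C: "\<And>m. (\<Sum>j<m. \<psi> (real n + real j)) \<le> C * \<psi> (real n) * lam (real n)"
    and n: "n \<ge> 1" and p: "p = n \<or> p = n + 1"
  defines "T \<equiv> \<lambda>m y. \<Sum>j<m. complex_of_real (\<psi> (real p + real j)) * cis (real j * y)"
  shows "cmod (T m y) \<le> \<psi> (real n) * (C * lam (real n))"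
    and "\<bar>y\<bar> \<le> pi \<Longrightarrow> \<bar>y\<bar> * cmod (T m y) \<le> \<psi> (real n) * pi"
proof -
  have nn: "0 \<le> \<psi> (real p + real j)" "0 \<le> \<psi> (real n + real j)" for j
    using n p by (auto intro!: psi_nonneg)
  have "cmod (T m y) \<le> (\<Sum>j<m. \<psi> (real p + real j))"
    unfolding T_def using nn by (intro sum_norm_le) (simp add: norm_mult)
  \<comment> \<open>One extra term covers the case p = n + 1, where the tail from n contains one
    earlier value.\<close>
  also have "\<dots> \<le> (\<Sum>j<m + 1. \<psi> (real n + real j))"
    using p
  proof
    assume "p = n"
    then show ?thesis using nn(2)[of m] by simp
  next
    assume "p = n + 1"
    then have "(\<Sum>j<m + 1. \<psi> (real n + real j)) = \<psi> (real n) + (\<Sum>j<m. \<psi> (real p + real j))"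
      using sum.lessThan_Suc_shift[of "\<lambda>j. \<psi> (real n + real j)" m] by (simp add: ac_simps)
    then show ?thesis using nn(2)[of 0] by simp
  qed
  also have "\<dots> \<le> \<psi> (real n) * (C * lam (real n))" using C[of "m + 1"] by (simp only: ac_simps)
  finally show "cmod (T m y) \<le> \<psi> (real n) * (C * lam (real n))" .
  assume y: "\<bar>y\<bar> \<le> pi"
  have "\<bar>y\<bar> * cmod (T m y) \<le> \<psi> (real p + real 0) * pi"
    unfolding T_def
    by (rule cmod_antimono_trig_sum_le[OF _ nn(1) nn(1) y]) (use n p in \<open>auto intro!: psi_anti\<close>)
  also have "\<dots> \<le> \<psi> (real n) * pi"
    using n p by (intro mult_right_mono) (auto intro!: psi_anti)
  finally show "\<bar>y\<bar> * cmod (T m y) \<le> \<psi> (real n) * pi" .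
qed

text \<open>The factor by which coefficients of the derivative become those of f; its phase undoes
  the one in \<open>is_psi_beta_deriv\<close>. It is used only at nonzero k.\<close>

definition multiplier :: "real \<Rightarrow> int \<Rightarrow> complex" where
  "multiplier \<beta> k = complex_of_real (\<psi> (real_of_int \<bar>k\<bar>)) * cis (- (\<beta> * pi / 2 * real_of_int (sgn k)))"

text \<open>Pulling out a unimodular factor lets each one-sided sum start at frequency 0 with
  decreasing coefficients, the form needed for Abel summation.\<close>

lemma remainder_kernel_eq:
  assumes p: "p \<ge> 1" "p \<le> N" and q: "q \<ge> 1" "q \<le> N"
  shows "(\<Sum>k\<in>{- int N..int N} - {1 - int p..int q - 1}. multiplier \<beta> k * cis (real_of_int k * y))
   = cis (real q * y - \<beta> * pi / 2) * (\<Sum>j<N + 1 - q. complex_of_real (\<psi> (real q + real j)) * cis (real j * y))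
   + cis (real p * (- y) + \<beta> * pi / 2) * (\<Sum>j<N + 1 - p. complex_of_real (\<psi> (real p + real j)) * cis (real j * (- y)))"
proof -
  let ?h = "\<lambda>k. multiplier \<beta> k * cis (real_of_int k * y)"
  have split: "{- int N..int N} - {1 - int p..int q - 1} = {int q..int N} \<union> {- int N..- int p}"
    using p q by auto
  have "sum ?h ({- int N..int N} - {1 - int p..int q - 1}) = sum ?h {int q..int N} + sum ?h {- int N..- int p}"
    unfolding split using p q by (intro sum.union_disjoint) auto
  also have "sum ?h {int q..int N} = (\<Sum>j<N + 1 - q. ?h (int (q + j)))"
    by (rule sum.reindex_bij_witness[of _ "\<lambda>j. int (q + j)" "\<lambda>k. nat k - q"]) (use q in auto)
  also have "\<dots> = (\<Sum>j<N + 1 - q. cis (real q * y - \<beta> * pi / 2) * (complex_of_real (\<psi> (real q + real j)) * cis (real j * y)))"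
    using q by (intro sum.cong refl) (simp add: multiplier_def cis_mult algebra_simps sgn_if)
  also have "sum ?h {- int N..- int p} = (\<Sum>j<N + 1 - p. ?h (- int (p + j)))"
    by (rule sum.reindex_bij_witness[of _ "\<lambda>j. - int (p + j)" "\<lambda>k. nat (- k) - p"]) (use p in auto)
  also have "\<dots> = (\<Sum>j<N + 1 - p. cis (real p * (- y) + \<beta> * pi / 2) * (complex_of_real (\<psi> (real p + real j)) * cis (real j * (- y))))"
    using p by (intro sum.cong refl) (simp add: multiplier_def cis_mult algebra_simps sgn_if)
  finally show ?thesis by (simp only: sum_distrib_left)
qed

lemma remainder_Lp_bound:
  assumes s: "s > 1"
  shows "\<exists>C>0. \<forall>n\<ge>1. \<forall>f\<in>L_class \<psi> \<beta> 1. \<forall>p\<in>{n, n + 1}. \<forall>q\<in>{n, n + 1}.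
    Lp_norm s (\<lambda>x. complex_of_real (f x) - (\<Sum>k\<in>{1 - int p..int q - 1}. fourier_coeff f k * cis (real_of_int k * x)))
      \<le> ennreal (C * (\<psi> (real n) * lam (real n) powr (1 - 1 / s)))"
proof -
  obtain C where C: "C > 0" "\<And>n m. n \<ge> 1 \<Longrightarrow> (\<Sum>j<m. \<psi> (real n + real j)) \<le> C * \<psi> (real n) * lam (real n)"
    using tail_sum by blast
  \<comment> \<open>The 2 counts the two one-sided kernels; the power of C comes from the peak
    height \<open>C * lam (real n)\<close>.\<close>
  define C' where "C' = peak_const s * 2 * C powr (1 - 1 / s)"
  have C': "C' > 0" using C peak_const_pos[OF s] by (simp add: C'_def)
  have "Lp_norm s (\<lambda>x. complex_of_real (f x) - (\<Sum>k\<in>{1 - int p..int q - 1}. fourier_coeff f k * cis (real_of_int k * x)))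
      \<le> ennreal (C' * (\<psi> (real n) * lam (real n) powr (1 - 1 / s)))"
    if n: "n \<ge> 1" and f: "f \<in> L_class \<psi> \<beta> 1" and p: "p \<in> {n, n + 1}" and q: "q \<in> {n, n + 1}" for n f p q
  proof -
    define E where "E = C' * (\<psi> (real n) * lam (real n) powr (1 - 1 / s))"
    have ln: "lam (real n) > 0" "\<psi> (real n) > 0" using lam_pos psi_pos n by auto
    have E0: "E > 0" using C' ln by (simp add: E_def)
    from f obtain \<phi> where fL: "in_Lp 1 f" and der: "is_psi_beta_deriv \<psi> \<beta> f \<phi>" and B0: "\<phi> \<in> B0 1"
      by (auto simp: L_class_def)
    have \<phi>L: "in_Lp 1 \<phi>" "Lp_norm 1 (\<lambda>x. complex_of_real (\<phi> x)) \<le> 1" using B0 by (auto simp: B0_def)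
    have [measurable]: "f \<in> borel_measurable borel" "\<phi> \<in> borel_measurable borel"
      using fL \<phi>L by (auto simp: in_Lp_def)
    define a where "a = fourier_coeff f"
    have a: "a k = multiplier \<beta> k * fourier_coeff \<phi> k" if "k \<noteq> 0" for k
    proof -
      have "\<psi> (real_of_int \<bar>k\<bar>) > 0" using that by (intro psi_pos) auto
      moreover have "fourier_coeff \<phi> k = a k / complex_of_real (\<psi> (real_of_int \<bar>k\<bar>)) * cis (\<beta> * pi / 2 * real_of_int (sgn k))"
        using der that by (simp add: is_psi_beta_deriv_def a_def)
      ultimately show ?thesis by (simp add: multiplier_def cis_mult)
    qed
    \<comment> \<open>The derivative does not control the mean of f, so frequency 0 is majorised by
      its own coefficient.\<close>
    define b where "b j = (if j = 0 then cmod (a 0) else \<psi> (real j))" for j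
    have b: "cmod (fourier_coeff f k) \<le> b (nat \<bar>k\<bar>)" for k
    proof (cases "k = 0")
      case False
      then have "\<psi> (real_of_int \<bar>k\<bar>) \<ge> 0" by (intro psi_nonneg) auto
      then show ?thesis
        using a[OF False] False cmod_fourier_coeff_le_1[OF \<phi>L, of k]
        by (simp add: a_def b_def multiplier_def norm_mult mult_left_le)
    qed (simp add: b_def a_def)
    have "summable (\<lambda>j. \<psi> (real 1 + real j))"
      by (rule summableI_nonneg_bounded[OF _ C(2)]) (auto intro: psi_nonneg)
    then have "summable (\<lambda>j. b (Suc j))" by (simp add: b_def)
    then have sb: "summable b" by (simp only: summable_Suc_iff)
    define \<gamma> where "\<gamma> = {1 - int p..int q - 1}"
    define r where "r x = complex_of_real (f x) - (\<Sum>k\<in>\<gamma>. a k * cis (real_of_int k * x))" for x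
    define rN where "rN N x = (\<Sum>k\<in>{- int N..int N} - \<gamma>. a k * cis (real_of_int k * x))" for N x
    have [measurable]: "r \<in> borel_measurable borel" unfolding r_def by measurable
    have [measurable]: "rN N \<in> borel_measurable borel" for N unfolding rN_def by measurable
    have pq: "p \<ge> 1" "q \<ge> 1" "p \<le> n + 1" "q \<le> n + 1" using p q n by auto
    have conv: "AE x in lborel. x \<in> {-pi..pi} \<longrightarrow> (\<lambda>N. rN N x) \<longlonglongrightarrow> r x"
      using fourier_series_AE_converges[OF in_Lp_1_set_integrable[OF fL] b sb]
    proof eventually_elim
      case (elim x)
      show ?case
      proof
        assume "x \<in> {-pi..pi}"
        then have "(\<lambda>N. \<Sum>k\<in>{- int N..int N}. a k * cis (real_of_int k * x)) \<longlonglongrightarrow> complex_of_real (f x)"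
          using elim by (simp add: a_def)
        then have *: "(\<lambda>N. (\<Sum>k\<in>{- int N..int N}. a k * cis (real_of_int k * x)) - (\<Sum>k\<in>\<gamma>. a k * cis (real_of_int k * x))) \<longlonglongrightarrow> r x"
          unfolding r_def by (intro tendsto_intros)
        have "\<forall>\<^sub>F N in sequentially. (\<Sum>k\<in>{- int N..int N}. a k * cis (real_of_int k * x)) - (\<Sum>k\<in>\<gamma>. a k * cis (real_of_int k * x)) = rN N x"
          using eventually_ge_at_top[of "n + 1"]
        proof eventually_elim
          case (elim N)
          have "\<gamma> \<subseteq> {- int N..int N}" using elim pq by (auto simp: \<gamma>_def)
          then show ?case unfolding rN_def by (intro sum_diff[symmetric]) auto
        qed
        with * show "(\<lambda>N. rN N x) \<longlonglongrightarrow> r x"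
          by (rule Lim_transform_eventually)
      qed
    qed
    have rN_le: "(\<integral>\<^sup>+x\<in>{-pi..pi}. ennreal (cmod (rN N x) powr s) \<partial>lborel) \<le> ennreal (E powr s)"
      if N: "N \<ge> n + 1" for N
    proof -
      define A where "A = {- int N..int N} - \<gamma>"
      have A: "finite A" "0 \<notin> A" using pq by (auto simp: A_def \<gamma>_def)
      define \<Phi> where "\<Phi> y = (\<Sum>k\<in>A. multiplier \<beta> k * cis (real_of_int k * y))" for y
      have [measurable]: "\<Phi> \<in> borel_measurable borel" unfolding \<Phi>_def by measurable
      define Tq where "Tq y = (\<Sum>j<N + 1 - q. complex_of_real (\<psi> (real q + real j)) * cis (real j * y))" for y
      define Tp where "Tp y = (\<Sum>j<N + 1 - p. complex_of_real (\<psi> (real p + real j)) * cis (real j * y))" for y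
      have \<Phi>_le: "cmod (\<Phi> y) \<le> cmod (Tq y) + cmod (Tp (- y))" for y
      proof -
        have "\<Phi> y = cis (real q * y - \<beta> * pi / 2) * Tq y + cis (real p * (- y) + \<beta> * pi / 2) * Tp (- y)"
          unfolding \<Phi>_def A_def \<gamma>_def Tq_def Tp_def using pq N by (intro remainder_kernel_eq) auto
        then show ?thesis
          using norm_triangle_ineq[of "cis (real q * y - \<beta> * pi / 2) * Tq y" "cis (real p * (- y) + \<beta> * pi / 2) * Tp (- y)"]
          by (simp add: norm_mult)
      qed
      have pq': "p = n \<or> p = n + 1" "q = n \<or> q = n + 1" using p q by auto
      note bd = one_sided_kernel_bounds[OF C(2)[OF n] n]
      have Tq: "cmod (Tq y) \<le> \<psi> (real n) * (C * lam (real n))"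
        "\<bar>y\<bar> \<le> pi \<Longrightarrow> \<bar>y\<bar> * cmod (Tq y) \<le> \<psi> (real n) * pi" for y
        unfolding Tq_def by (rule bd[OF pq'(2)], rule bd(2)[OF pq'(2)])
      have Tp: "cmod (Tp y) \<le> \<psi> (real n) * (C * lam (real n))"
        "\<bar>y\<bar> \<le> pi \<Longrightarrow> \<bar>y\<bar> * cmod (Tp y) \<le> \<psi> (real n) * pi" for y
        unfolding Tp_def by (rule bd[OF pq'(1)], rule bd(2)[OF pq'(1)])
      have "(\<integral>\<^sup>+x\<in>{-pi..pi}. ennreal (cmod (rN N x) powr s) \<partial>lborel)
         \<le> (\<integral>\<^sup>+x\<in>{-pi..pi}. ennreal (cmod (\<Phi> x) powr s) \<partial>lborel)"
      proof (rule nn_integral_convolution_powr_le[OF s])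
        show "(\<integral>\<^sup>+t\<in>{-pi..pi}. ennreal \<bar>\<phi> t\<bar> \<partial>lborel) \<le> 1" by (rule nn_integral_abs_le_1[OF \<phi>L])
        show "periodic2pi \<Phi>" unfolding \<Phi>_def by (rule trig_polynomial_periodic)
        fix x
        have "rN N x = (\<Sum>k\<in>A. multiplier \<beta> k * fourier_coeff \<phi> k * cis (real_of_int k * x))"
          unfolding rN_def A_def[symmetric]
        proof (rule sum.cong[OF refl])
          fix k assume "k \<in> A"
          then have k: "k \<noteq> 0" using A(2) by metis
          show "a k * cis (real_of_int k * x) = multiplier \<beta> k * fourier_coeff \<phi> k * cis (real_of_int k * x)"
            by (simp only: a[OF k])
        qed
        then show "ennreal (cmod (rN N x)) \<le> (\<integral>\<^sup>+t\<in>{-pi..pi}. ennreal (\<bar>\<phi> t\<bar> * cmod (\<Phi> (x - t))) \<partial>lborel)"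
          using multiplier_convolution_le[OF A(1) in_Lp_1_set_integrable[OF \<phi>L(1)], of "multiplier \<beta>" x]
          by (simp add: \<Phi>_def)
      qed measurable
      also have "\<dots> \<le> ennreal ((peak_const s * (2 * \<psi> (real n)) * (C * lam (real n)) powr (1 - 1 / s)) powr s)"
      proof (rule Lp_peak_bound[OF s])
        show "cmod (\<Phi> x) \<le> 2 * \<psi> (real n) * (C * lam (real n))" for x
          using \<Phi>_le[of x] Tq(1)[of x] Tp(1)[of "- x"] by simp
        fix x :: real assume x: "\<bar>x\<bar> \<le> pi"
        have "\<bar>x\<bar> * cmod (\<Phi> x) \<le> \<bar>x\<bar> * cmod (Tq x) + \<bar>- x\<bar> * cmod (Tp (- x))"
          using mult_left_mono[OF \<Phi>_le[of x], of "\<bar>x\<bar>"] by (simp add: ring_distribs)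
        also have "\<dots> \<le> \<psi> (real n) * pi + \<psi> (real n) * pi"
          using x by (intro add_mono Tq(2) Tp(2)) auto
        finally show "\<bar>x\<bar> * cmod (\<Phi> x) \<le> 2 * \<psi> (real n) * pi" by (simp add: ac_simps)
      qed (use ln C in auto)
      also have "peak_const s * (2 * \<psi> (real n)) * (C * lam (real n)) powr (1 - 1 / s) = E"
        using ln C by (simp add: E_def C'_def powr_mult)
      finally show ?thesis .
    qed
    \<comment> \<open>Fatou's lemma: the bound for \<open>rN N\<close> is uniform in N, and
      \<open>rN N\<close> tends to r almost everywhere.\<close>
    have "(\<integral>\<^sup>+x\<in>{-pi..pi}. ennreal (cmod (r x) powr s) \<partial>lborel)
       \<le> (\<integral>\<^sup>+x. liminf (\<lambda>N. ennreal (cmod (rN N x) powr s) * indicator {-pi..pi} x) \<partial>lborel)"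
    proof (rule nn_integral_mono_AE)
      show "AE x in lborel. ennreal (cmod (r x) powr s) * indicator {-pi..pi} x
         \<le> liminf (\<lambda>N. ennreal (cmod (rN N x) powr s) * indicator {-pi..pi} x)"
        using conv
      proof eventually_elim
        case (elim x)
        show ?case
        proof (cases "x \<in> {-pi..pi}")
          case True
          then have "(\<lambda>N. ennreal (cmod (rN N x) powr s)) \<longlonglongrightarrow> ennreal (cmod (r x) powr s)"
            using elim s by (intro tendsto_ennrealI tendsto_powr' tendsto_norm tendsto_const) auto
          then show ?thesis using True lim_imp_Liminf[OF trivial_limit_sequentially] by fastforce
        qed simp
      qed
    qed
    also have "\<dots> \<le> liminf (\<lambda>N. \<integral>\<^sup>+x\<in>{-pi..pi}. ennreal (cmod (rN N x) powr s) \<partial>lborel)"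
      by (rule nn_integral_liminf) measurable
    also have "\<dots> \<le> liminf (\<lambda>N. ennreal (E powr s))"
      by (rule Liminf_mono) (use eventually_ge_at_top[of "n + 1"] in eventually_elim, rule rN_le)
    also have "\<dots> = ennreal (E powr s)" by (simp add: Liminf_const)
    finally have fin: "(\<integral>\<^sup>+x\<in>{-pi..pi}. ennreal (cmod (r x) powr s) \<partial>lborel) \<le> ennreal (E powr s)" .
    have "periodic2pi r"
      using fL unfolding r_def by (simp add: periodic2pi_def cis_periodic in_Lp_def)
    then have "Lp_norm s r \<le> ennreal E"
      using fin E0 s by (subst Lp_norm_le_iff) auto
    then show ?thesis by (simp add: r_def[abs_def] a_def \<gamma>_def E_def)
  qed
  then show ?thesis using C' by blast
qed

lemma e_orth_class_upper:
  assumes s: "s > 1"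
  shows "\<exists>C>0. \<forall>n\<ge>1. \<forall>m\<in>{2 * n - 1, 2 * n}. e_orth_class m (L_class \<psi> \<beta> 1) s
      \<le> ennreal (C * (\<psi> (real n) * lam (real n) powr (1 - 1 / s)))"
proof -
  obtain C where C: "C > 0" "\<And>n f p q. n \<ge> 1 \<Longrightarrow> f \<in> L_class \<psi> \<beta> 1 \<Longrightarrow> p \<in> {n, n + 1} \<Longrightarrow> q \<in> {n, n + 1} \<Longrightarrow>
    Lp_norm s (\<lambda>x. complex_of_real (f x) - (\<Sum>k\<in>{1 - int p..int q - 1}. fourier_coeff f k * cis (real_of_int k * x)))
      \<le> ennreal (C * (\<psi> (real n) * lam (real n) powr (1 - 1 / s)))"
    using remainder_Lp_bound[OF s, of \<beta>] by blast
  have "e_orth_class m (L_class \<psi> \<beta> 1) s \<le> ennreal (C * (\<psi> (real n) * lam (real n) powr (1 - 1 / s)))"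
    if n: "n \<ge> 1" and m: "m \<in> {2 * n - 1, 2 * n}" for n m
    unfolding e_orth_class_def
  proof (rule SUP_least)
    fix f assume f: "f \<in> L_class \<psi> \<beta> 1"
    \<comment> \<open>The block from 1 - n to q - 1 has n + q - 1 elements, which makes q equal to n
      for m = 2n - 1 and n + 1 for m = 2n.\<close>
    define q where "q = m + 1 - n"
    have q: "q \<in> {n, n + 1}" "n + q = m + 1" using m n by (auto simp: q_def)
    let ?\<gamma> = "{1 - int n..int q - 1}"
    have card: "card ?\<gamma> = m" using q n by auto
    have "e_orth m f s \<le> Lp_norm s (\<lambda>x. complex_of_real (f x) - (\<Sum>k\<in>?\<gamma>. fourier_coeff f k * cis (real_of_int k * x)))"
      unfolding e_orth_def by (rule INF_lower) (use card in simp)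
    also have "\<dots> \<le> ennreal (C * (\<psi> (real n) * lam (real n) powr (1 - 1 / s)))"
      by (rule C(2)) (use n f q in auto)
    finally show "e_orth m f s \<le> ennreal (C * (\<psi> (real n) * lam (real n) powr (1 - 1 / s)))" .
  qed
  then show ?thesis using C(1) by blast
qed

end

section \<open>Lower bound\<close>

text \<open>The difference k occurs for N - |k| pairs. In the induction the new row and column
  together contribute each k with |k| at most N exactly once.\<close>

lemma Fejer_double_sum:
  fixes h :: "int \<Rightarrow> complex"
  shows "(\<Sum>j<N. \<Sum>l<N. h (int j - int l)) = (\<Sum>k\<in>{- int N<..<int N}. of_int (int N - \<bar>k\<bar>) * h k)"
proof (induction N)
  case (Suc N)
  have "(\<Sum>j<Suc N. \<Sum>l<Suc N. h (int j - int l))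
     = (\<Sum>j<N. \<Sum>l<N. h (int j - int l)) + (\<Sum>j<N. h (int j - int N)) + (\<Sum>l<Suc N. h (int N - int l))"
    by (simp add: sum.distrib)
  also have "(\<Sum>j<N. h (int j - int N)) = (\<Sum>k\<in>{- int N..<0}. h k)"
    by (rule sum.reindex_bij_witness[of _ "\<lambda>k. nat (k + int N)" "\<lambda>j. int j - int N"]) auto
  also have "(\<Sum>l<Suc N. h (int N - int l)) = (\<Sum>k\<in>{0..int N}. h k)"
    by (rule sum.reindex_bij_witness[of _ "\<lambda>k. nat (int N - k)" "\<lambda>l. int N - int l"]) auto
  also have "(\<Sum>j<N. \<Sum>l<N. h (int j - int l)) = (\<Sum>k\<in>{- int N..int N}. of_int (int N - \<bar>k\<bar>) * h k)"
    unfolding Suc.IH by (rule sum.mono_neutral_left) auto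
  also have "\<dots> + (\<Sum>k\<in>{- int N..<0}. h k) + (\<Sum>k\<in>{0..int N}. h k)
     = (\<Sum>k\<in>{- int N..int N}. of_int (int N - \<bar>k\<bar>) * h k) + (\<Sum>k\<in>{- int N..<0} \<union> {0..int N}. h k)"
    by (subst sum.union_disjoint) auto
  also have "{- int N..<0} \<union> {0..int N} = {- int N..int N}" by auto
  also have "(\<Sum>k\<in>{- int N..int N}. of_int (int N - \<bar>k\<bar>) * h k) + (\<Sum>k\<in>{- int N..int N}. h k)
     = (\<Sum>k\<in>{- int N..int N}. of_int (int (Suc N) - \<bar>k\<bar>) * h k)"
    by (simp add: sum.distrib[symmetric] algebra_simps)
  also have "{- int N..int N} = {- int (Suc N)<..<int (Suc N)}" by auto
  finally show ?case .
qed simp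

text \<open>The kernel is the squared modulus of a one-sided Dirichlet sum.\<close>

lemma Fejer_kernel_nonneg:
  "\<exists>v\<ge>0. (\<Sum>k\<in>{- int N<..<int N}. of_int (int N - \<bar>k\<bar>) * cis (real_of_int k * x)) = complex_of_real v"
proof -
  let ?D = "\<Sum>j<N. cis (real j * x)"
  have "?D * cnj ?D = (\<Sum>j<N. \<Sum>l<N. cis (real_of_int (int j - int l) * x))"
    by (simp add: sum_product cis_cnj cis_mult left_diff_distrib)
  also have "\<dots> = (\<Sum>k\<in>{- int N<..<int N}. of_int (int N - \<bar>k\<bar>) * cis (real_of_int k * x))"
    by (rule Fejer_double_sum)
  finally show ?thesis
    by (intro exI[of _ "(cmod ?D)\<^sup>2"]) (simp only: complex_norm_square zero_le_power2 simp_thms)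
qed

section \<open>Real trigonometric polynomials and the extremal derivative\<close>

lemma real_trig_polynomial:
  assumes "\<And>k. k \<in> A \<Longrightarrow> - k \<in> A" "\<And>k. k \<in> A \<Longrightarrow> a (- k) = cnj (a k)"
  shows "complex_of_real (Re (\<Sum>k\<in>A. a k * cis (real_of_int k * x))) = (\<Sum>k\<in>A. a k * cis (real_of_int k * x))"
proof -
  have "cnj (\<Sum>k\<in>A. a k * cis (real_of_int k * x)) = (\<Sum>k\<in>A. a (- k) * cis (real_of_int (- k) * x))"
    using assms(2) by (simp add: cis_cnj)
  also have "\<dots> = (\<Sum>k\<in>A. a k * cis (real_of_int k * x))"
    by (rule sum.reindex_bij_witness[of _ uminus uminus]) (use assms(1) in auto)
  finally have "(\<Sum>k\<in>A. a k * cis (real_of_int k * x)) \<in> \<real>"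
    by (simp add: Reals_cnj_iff)
  then show ?thesis by (rule of_real_Re)
qed

lemma trig_polynomial_measurable [measurable]:
  "(\<lambda>x. \<Sum>k\<in>A. a k * cis (real_of_int k * x)) \<in> borel_measurable borel"
  by measurable

lemma trig_polynomial_bound:
  "cmod (\<Sum>k\<in>A. a k * cis (real_of_int k * x)) \<le> (\<Sum>k\<in>A. cmod (a k))"
  by (intro sum_norm_le) (simp add: norm_mult)

lemma trig_polynomial_in_Lp_1:
  assumes "\<And>x. complex_of_real (f x) = (\<Sum>k\<in>A. a k * cis (real_of_int k * x))"
  shows "in_Lp 1 f"
proof -
  have f: "f = (\<lambda>x. Re (\<Sum>k\<in>A. a k * cis (real_of_int k * x)))"
    using assms by (metis Re_complex_of_real)
  have m[measurable]: "f \<in> borel_measurable borel" unfolding f by measurable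
  have p: "periodic2pi f" unfolding f by (simp only: periodic2pi_def cis_periodic) simp
  define B where "B = (\<Sum>k\<in>A. cmod (a k))"
  have B0: "B \<ge> 0" unfolding B_def by (intro sum_nonneg) auto
  have B: "\<bar>f x\<bar> \<le> B" for x
    using trig_polynomial_bound[of a x A] assms[of x] by (metis B_def norm_of_real real_norm_def)
  have "(\<integral>\<^sup>+x\<in>{-pi..pi}. ennreal (cmod (complex_of_real (f x)) powr 1) \<partial>lborel)
      \<le> (\<integral>\<^sup>+x\<in>{-pi..pi}. ennreal B \<partial>lborel)"
    using B by (intro nn_integral_mono mult_right_mono ennreal_leI) auto
  also have "\<dots> = ennreal ((B * (2 * pi)) powr 1)"
    using B0 by (simp add: nn_integral_cmult ennreal_mult')
  finally have "Lp_norm 1 (\<lambda>x. complex_of_real (f x)) \<le> ennreal (B * (2 * pi))"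
    using p B0 by (subst Lp_norm_le_iff) (auto simp: periodic2pi_def)
  then have "Lp_norm 1 (\<lambda>x. complex_of_real (f x)) < \<infinity>"
    using le_less_trans ennreal_less_top by (metis infinity_ennreal_def)
  then show ?thesis using p m by (simp add: in_Lp_def)
qed

text \<open>The scale gives the Fejer kernel total mass 1/2 on the circle. Removing its mean 1 / (4
  pi) costs at most another 1/2, so the L_1 norm of the difference is at most 1.\<close>

definition fejer_coeff :: "nat \<Rightarrow> int \<Rightarrow> real" where
  "fejer_coeff N k = (1 - \<bar>of_int k\<bar> / real N) / (4 * pi)"

lemma fejer_extremal_in_B0:
  fixes \<phi> :: "real \<Rightarrow> real"
  assumes N: "N \<ge> 1"
    and \<phi>: "\<And>x. complex_of_real (\<phi> x) = (\<Sum>k\<in>{- int N<..<int N} - {0}. complex_of_real (fejer_coeff N k) * cis (real_of_int k * x))"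
  shows "\<phi> \<in> B0 1"
proof -
  let ?A = "{- int N<..<int N}"
  let ?V = "\<lambda>x. \<Sum>k\<in>?A. complex_of_real (fejer_coeff N k) * cis (real_of_int k * x)"
  have in1: "in_Lp 1 \<phi>" by (rule trig_polynomial_in_Lp_1[OF \<phi>])
  have [measurable]: "\<phi> \<in> borel_measurable borel" and per: "periodic2pi \<phi>" using in1 by (auto simp: in_Lp_def)
  have V\<phi>: "?V x = complex_of_real (\<phi> x + 1 / (4 * pi))" for x
    using N \<phi>[of x] by (subst sum.remove[of _ 0]) (auto simp: fejer_coeff_def)
  have Vnn: "\<phi> x + 1 / (4 * pi) \<ge> 0" for x
  proof -
    obtain v where v: "v \<ge> 0" "(\<Sum>k\<in>?A. of_int (int N - \<bar>k\<bar>) * cis (real_of_int k * x)) = complex_of_real v"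
      using Fejer_kernel_nonneg by blast
    have "?V x = (\<Sum>k\<in>?A. complex_of_real (1 / (4 * pi * real N)) * (of_int (int N - \<bar>k\<bar>) * cis (real_of_int k * x)))"
    proof (rule sum.cong[OF refl])
      fix k
      have "fejer_coeff N k = 1 / (4 * pi * real N) * of_int (int N - \<bar>k\<bar>)"
        using N by (simp add: fejer_coeff_def field_simps)
      then have "complex_of_real (fejer_coeff N k) = complex_of_real (1 / (4 * pi * real N)) * of_int (int N - \<bar>k\<bar>)"
        by (simp only: of_real_mult of_real_of_int_eq)
      then show "complex_of_real (fejer_coeff N k) * cis (real_of_int k * x)
        = complex_of_real (1 / (4 * pi * real N)) * (of_int (int N - \<bar>k\<bar>) * cis (real_of_int k * x))"
        by simp
    qed
    also have "\<dots> = complex_of_real (1 / (4 * pi * real N) * v)"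
      by (simp only: sum_distrib_left[symmetric] v of_real_mult)
    finally have "\<phi> x + 1 / (4 * pi) = 1 / (4 * pi * real N) * v"
      unfolding V\<phi> of_real_eq_iff .
    then show ?thesis using v by simp
  qed
  have coeff0: "fourier_coeff \<phi> 0 = 0"
    using fourier_coeff_trig_polynomial[OF _ \<phi>, of 0] by simp
  then have int0: "(LINT t:{-pi..pi}|lborel. \<phi> t) = 0"
    by (simp add: fourier_coeff_def set_lebesgue_integral_def flip: of_real_mult add: scaleR_conv_of_real)
  have int: "set_integrable lborel {-pi..pi} \<phi>" by (rule in_Lp_1_set_integrable[OF in1])
  have "integrable lborel (indicator {-pi..pi} :: real \<Rightarrow> real)"
    by (simp add: integrable_real_indicator)
  then have int1: "set_integrable lborel {-pi..pi} (\<lambda>x. \<phi> x + 1 / (4 * pi))"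
    using int by (intro set_integral_add) (auto simp: set_integrable_def)
  have "(\<integral>\<^sup>+x\<in>{-pi..pi}. ennreal (\<phi> x + 1 / (4 * pi)) \<partial>lborel)
    = (\<integral>\<^sup>+x. ennreal (indicator {-pi..pi} x *\<^sub>R (\<phi> x + 1 / (4 * pi))) \<partial>lborel)"
    by (intro nn_integral_cong) (auto simp: indicator_def)
  also have "\<dots> = ennreal (LINT x:{-pi..pi}|lborel. \<phi> x + 1 / (4 * pi))"
    unfolding set_lebesgue_integral_def
    using int1 Vnn by (intro nn_integral_eq_integral) (auto simp: set_integrable_def)
  also have "(LINT x:{-pi..pi}|lborel. \<phi> x + 1 / (4 * pi)) = (LINT x:{-pi..pi}|lborel. 1 / (4 * pi))"
    using int0 int by (subst set_integral_add) (auto simp: set_integrable_def)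
  also have "\<dots> = 1 / 2"
    by (simp add: set_lebesgue_integral_def)
  finally have V: "(\<integral>\<^sup>+x\<in>{-pi..pi}. ennreal (\<phi> x + 1 / (4 * pi)) \<partial>lborel) = ennreal (1 / 2)" .
  have c: "(\<integral>\<^sup>+x\<in>{-pi..pi}. ennreal (1 / (4 * pi)) \<partial>lborel) = ennreal (1 / 2)"
    by (simp add: nn_integral_cmult flip: ennreal_mult')
  have "(\<integral>\<^sup>+x\<in>{-pi..pi}. ennreal (cmod (complex_of_real (\<phi> x)) powr 1) \<partial>lborel)
    \<le> (\<integral>\<^sup>+x. ennreal (\<phi> x + 1 / (4 * pi)) * indicator {-pi..pi} x + ennreal (1 / (4 * pi)) * indicator {-pi..pi} x \<partial>lborel)"
  proof (rule nn_integral_mono)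
    fix x
    have "\<bar>\<phi> x\<bar> \<le> (\<phi> x + 1 / (4 * pi)) + 1 / (4 * pi)" using Vnn[of x] by (simp add: abs_if)
    then have "ennreal \<bar>\<phi> x\<bar> \<le> ennreal (\<phi> x + 1 / (4 * pi)) + ennreal (1 / (4 * pi))"
      using Vnn[of x] by (subst ennreal_plus[symmetric]) (auto intro: ennreal_leI)
    then show "ennreal (cmod (complex_of_real (\<phi> x)) powr 1) * indicator {-pi..pi} x
      \<le> ennreal (\<phi> x + 1 / (4 * pi)) * indicator {-pi..pi} x + ennreal (1 / (4 * pi)) * indicator {-pi..pi} x"
      by (simp add: indicator_def)
  qed
  also have "\<dots> = ennreal (1 / 2) + ennreal (1 / 2)"
    by (subst nn_integral_add) (simp_all only: V c, measurable)
  also have "\<dots> = ennreal (1 powr 1)" by (subst ennreal_plus[symmetric]) auto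
  finally have "Lp_norm 1 (\<lambda>x. complex_of_real (\<phi> x)) \<le> ennreal 1"
    using per by (subst Lp_norm_le_iff) (auto simp: periodic2pi_def)
  then show ?thesis using in1 int0 by (simp add: B0_def)
qed

section \<open>Duality against a test polynomial\<close>

lemma integral_pairing_le:
  fixes r g :: "real \<Rightarrow> complex"
  assumes pq: "p > 1" "q > 1" "1 / p + 1 / q = 1" and XY: "X > 0" "Y > 0"
    and [measurable]: "r \<in> borel_measurable borel" "g \<in> borel_measurable borel"
    and i: "set_integrable lborel {-pi..pi} (\<lambda>x. r x * g x)"
    and r: "(\<integral>\<^sup>+x\<in>{-pi..pi}. ennreal (cmod (r x) powr p) \<partial>lborel) \<le> ennreal (X powr p)"
    and g: "(\<integral>\<^sup>+x\<in>{-pi..pi}. ennreal (cmod (g x) powr q) \<partial>lborel) \<le> ennreal (Y powr q)"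
  shows "cmod (LINT x:{-pi..pi}|lborel. r x * g x) \<le> X * Y"
proof -
  let ?u = "\<lambda>x. indicator {-pi..pi} x * cmod (r x)" and ?v = "\<lambda>x. indicator {-pi..pi} x * cmod (g x)"
  have "(\<integral>\<^sup>+x. ennreal (?u x * ?v x) \<partial>lborel) \<le> ennreal (X * Y)"
  proof (rule nn_integral_Holder[OF pq])
    have "ennreal (?u x powr p) = ennreal (cmod (r x) powr p) * indicator {-pi..pi} x" for x
      by (auto simp: indicator_def)
    then show "(\<integral>\<^sup>+x. ennreal (?u x powr p) \<partial>lborel) \<le> ennreal (X powr p)" using r by simp
    have "ennreal (?v x powr q) = ennreal (cmod (g x) powr q) * indicator {-pi..pi} x" for x
      by (auto simp: indicator_def)
    then show "(\<integral>\<^sup>+x. ennreal (?v x powr q) \<partial>lborel) \<le> ennreal (Y powr q)" using g by simp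
  qed (use XY in auto)
  also have "(\<integral>\<^sup>+x. ennreal (?u x * ?v x) \<partial>lborel) = (\<integral>\<^sup>+x\<in>{-pi..pi}. ennreal (cmod (r x * g x)) \<partial>lborel)"
    by (intro nn_integral_cong) (auto simp: indicator_def norm_mult)
  finally have "ennreal (cmod (LINT x:{-pi..pi}|lborel. r x * g x)) \<le> ennreal (X * Y)"
    using norm_set_integral_le_nn[OF i] by (rule order_trans[rotated])
  then show ?thesis using XY by simp
qed

lemma symmetric_interval_sum:
  fixes h :: "int \<Rightarrow> complex"
  shows "(\<Sum>k\<in>{- int M..int M} - {0}. h k) = (\<Sum>k=1..M. h (int k)) + (\<Sum>k=1..M. h (- int k))"
proof -
  have "{- int M..int M} - {0} = {1..int M} \<union> {- int M..- 1}" by auto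
  then have "(\<Sum>k\<in>{- int M..int M} - {0}. h k) = (\<Sum>k\<in>{1..int M}. h k) + (\<Sum>k\<in>{- int M..- 1}. h k)"
    by (simp add: sum.union_disjoint)
  also have "(\<Sum>k\<in>{1..int M}. h k) = (\<Sum>k=1..M. h (int k))"
    by (rule sum.reindex_bij_witness[of _ int nat]) auto
  also have "(\<Sum>k\<in>{- int M..- 1}. h k) = (\<Sum>k=1..M. h (- int k))"
    by (rule sum.reindex_bij_witness[of _ "\<lambda>k. - int k" "\<lambda>k. nat (- k)"]) auto
  finally show ?thesis .
qed

context rapidly_decaying
begin

text \<open>Counting frequencies down from M makes the coefficients decrease, so the monotone
  estimate applies with the largest coefficient, the one at M, in front.\<close>

lemma increasing_trig_sum_le:
  assumes y: "\<bar>y\<bar> \<le> pi" and M: "M \<ge> 1" and c: "c \<ge> 0"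
  shows "\<bar>y\<bar> * cmod (\<Sum>k=1..M. complex_of_real (c / \<psi> (real k)) * cis (real k * y)) \<le> c / \<psi> (real M) * pi"
proof -
  have "(\<Sum>k=1..M. complex_of_real (c / \<psi> (real k)) * cis (real k * y))
     = (\<Sum>j<M. cis (real M * y) * (complex_of_real (c / \<psi> (real (M - j))) * cis (real j * (- y))))"
  proof (rule sum.reindex_bij_witness[of _ "\<lambda>j. M - j" "\<lambda>k. M - k"])
    fix k assume k: "k \<in> {1..M}"
    then have "cis (real M * y) * cis (real (M - k) * (- y)) = cis (real k * y)"
      by (simp add: cis_mult of_nat_diff algebra_simps)
    then show "cis (real M * y) * (complex_of_real (c / \<psi> (real (M - (M - k)))) * cis (real (M - k) * (- y)))
       = complex_of_real (c / \<psi> (real k)) * cis (real k * y)"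
      using k by (simp add: mult.left_commute)
  qed auto
  also have "cmod \<dots> = cmod (\<Sum>j<M. complex_of_real (c / \<psi> (real (M - j))) * cis (real j * (- y)))"
    by (simp only: sum_distrib_left[symmetric] norm_mult norm_cis mult_1)
  finally have eq: "cmod (\<Sum>k=1..M. complex_of_real (c / \<psi> (real k)) * cis (real k * y))
     = cmod (\<Sum>j<M. complex_of_real (c / \<psi> (real (M - j))) * cis (real j * (- y)))" .
  have "\<bar>- y\<bar> * cmod (\<Sum>j<M. complex_of_real (c / \<psi> (real (M - j))) * cis (real j * (- y)))
     \<le> c / \<psi> (real (M - 0)) * pi"
  proof (rule cmod_antimono_trig_sum_le)
    fix j assume "Suc j < M"
    then show "c / \<psi> (real (M - Suc j)) \<le> c / \<psi> (real (M - j))"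
      using c by (intro divide_left_mono psi_anti mult_pos_pos psi_pos) auto
  qed (use y M c in \<open>auto intro!: divide_nonneg_nonneg psi_nonneg\<close>)
  then show ?thesis unfolding eq by (simp only: abs_minus_cancel diff_zero)
qed

text \<open>The inverse of \<open>multiplier\<close> scaled by psi(n): for nonzero k their product
  is exactly psi(n).\<close>

definition test_coeff :: "real \<Rightarrow> nat \<Rightarrow> int \<Rightarrow> complex" where
  "test_coeff \<beta> n k = complex_of_real (\<psi> (real n) / \<psi> (real_of_int \<bar>k\<bar>)) * cis (\<beta> * pi / 2 * real_of_int (sgn k))"

text \<open>The height comes from \<open>ratio_sum\<close> and the decay from
  \<open>increasing_trig_sum_le\<close>, whose largest coefficient is controlled by
  \<open>psi_ratio_ceiling\<close>. Frequencies appear as -k because the later pairing has no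
  complex conjugation.\<close>

lemma test_function_Lp_bound:
  assumes q: "q > 1"
  shows "\<exists>Y>0. \<forall>n\<ge>1. \<forall>M. real M > eta \<psi> (real n) \<longrightarrow> real M \<le> eta \<psi> (real n) + 1 \<longrightarrow>
    (\<integral>\<^sup>+x\<in>{-pi..pi}. ennreal (cmod (\<Sum>k\<in>{- int M..int M} - {0}. test_coeff \<beta> n k * cis (real_of_int (- k) * x)) powr q) \<partial>lborel)
      \<le> ennreal ((Y * lam (real n) powr (1 - 1 / q)) powr q)"
proof -
  obtain C where C: "C > 0" "\<And>n M. n \<ge> 1 \<Longrightarrow> real M > eta \<psi> (real n) \<Longrightarrow> real M \<le> eta \<psi> (real n) + 1 \<Longrightarrow>
    (\<Sum>k=1..M. \<psi> (real n) / \<psi> (real k)) \<le> C * lam (real n)"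
    using ratio_sum by blast
  define D where "D = 2 * exp (1 / alpha 1)"
  have D: "D \<ge> 1"
    using alpha_pos[of 1] exp_ge_add_one_self[of "1 / alpha 1"] unfolding D_def by (smt (verit) divide_pos_pos)
  define Y where "Y = peak_const q * (2 * D) * C powr (1 - 1 / q)"
  have Y: "Y > 0" using peak_const_pos[OF q] C D by (simp add: Y_def)
  have "(\<integral>\<^sup>+x\<in>{-pi..pi}. ennreal (cmod (\<Sum>k\<in>{- int M..int M} - {0}. test_coeff \<beta> n k * cis (real_of_int (- k) * x)) powr q) \<partial>lborel)
      \<le> ennreal ((Y * lam (real n) powr (1 - 1 / q)) powr q)"
    if n: "n \<ge> 1" and M: "real M > eta \<psi> (real n)" "real M \<le> eta \<psi> (real n) + 1" for n M
  proof -
    define g where "g x = (\<Sum>k\<in>{- int M..int M} - {0}. test_coeff \<beta> n k * cis (real_of_int (- k) * x))" for x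
    define S where "S y = (\<Sum>k=1..M. complex_of_real (\<psi> (real n) / \<psi> (real k)) * cis (real k * y))" for y
    have ln: "lam (real n) > 0" "\<psi> (real n) > 0" using lam_pos psi_pos n by auto
    have "real M > real n" using eta_props[of "real n"] n M by simp
    then have M1: "M \<ge> 1" by simp
    have g: "g x = cis (\<beta> * pi / 2) * S (- x) + cis (- (\<beta> * pi / 2)) * S x" for x
      unfolding g_def S_def symmetric_interval_sum sum_distrib_left
      by (intro arg_cong2[of _ _ _ _ "(+)"] sum.cong refl) (auto simp: test_coeff_def sgn_if)
    have g_le: "cmod (g x) \<le> cmod (S (- x)) + cmod (S x)" for x
      using norm_triangle_ineq[of "cis (\<beta> * pi / 2) * S (- x)" "cis (- (\<beta> * pi / 2)) * S x"]
      by (simp add: g norm_mult)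
    have S1: "cmod (S y) \<le> C * lam (real n)" for y
    proof -
      have "cmod (S y) \<le> (\<Sum>k=1..M. \<psi> (real n) / \<psi> (real k))"
        unfolding S_def using n by (intro sum_norm_le) (auto simp: norm_mult norm_divide psi_nonneg)
      also have "\<dots> \<le> C * lam (real n)" by (rule C(2)[OF n M])
      finally show ?thesis .
    qed
    have S2: "\<bar>y\<bar> * cmod (S y) \<le> D * pi" if "\<bar>y\<bar> \<le> pi" for y
    proof -
      have "\<bar>y\<bar> * cmod (S y) \<le> \<psi> (real n) / \<psi> (real M) * pi"
        unfolding S_def using that M1 ln by (intro increasing_trig_sum_le) auto
      also have "\<dots> \<le> D * pi"
        using psi_ratio_ceiling[OF n M] by (intro mult_right_mono) (auto simp: D_def)
      finally show ?thesis .
    qed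
    have "(\<integral>\<^sup>+x\<in>{-pi..pi}. ennreal (cmod (g x) powr q) \<partial>lborel)
      \<le> ennreal ((peak_const q * (2 * D) * (C * lam (real n)) powr (1 - 1 / q)) powr q)"
    proof (rule Lp_peak_bound[OF q])
      fix x
      have "cmod (g x) \<le> 2 * (C * lam (real n))" using g_le[of x] S1[of x] S1[of "- x"] by simp
      \<comment> \<open>The height bound is weakened by D >= 1 because the peak estimate uses one
        amplitude for both height and decay.\<close>
      also have "\<dots> \<le> D * (2 * (C * lam (real n)))"
        using mult_right_mono[OF D, of "2 * (C * lam (real n))"] C ln by simp
      finally show "cmod (g x) \<le> 2 * D * (C * lam (real n))" by (simp add: ac_simps)
    next
      fix x :: real assume x: "\<bar>x\<bar> \<le> pi"
      have "\<bar>x\<bar> * cmod (g x) \<le> \<bar>- x\<bar> * cmod (S (- x)) + \<bar>x\<bar> * cmod (S x)"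
        using mult_left_mono[OF g_le[of x], of "\<bar>x\<bar>"] by (simp add: ring_distribs)
      also have "\<dots> \<le> D * pi + D * pi" using x by (intro add_mono S2) auto
      finally show "\<bar>x\<bar> * cmod (g x) \<le> 2 * D * pi" by (simp add: ac_simps)
    qed (use C D ln in auto)
    also have "peak_const q * (2 * D) * (C * lam (real n)) powr (1 - 1 / q) = Y * lam (real n) powr (1 - 1 / q)"
      using C ln by (simp add: Y_def powr_mult)
    finally show ?thesis by (simp add: g_def)
  qed
  then show ?thesis using Y by blast
qed

lemma extremal_function:
  assumes N: "N \<ge> 1"
  obtains f where "f \<in> L_class \<psi> \<beta> 1"
    "\<And>x. complex_of_real (f x) = (\<Sum>k\<in>{- int N<..<int N} - {0}. complex_of_real (fejer_coeff N k) * multiplier \<beta> k * cis (real_of_int k * x))"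
proof -
  let ?A = "{- int N<..<int N} - {0}"
  define \<phi> where "\<phi> x = Re (\<Sum>k\<in>?A. complex_of_real (fejer_coeff N k) * cis (real_of_int k * x))" for x
  define f where "f x = Re (\<Sum>k\<in>?A. complex_of_real (fejer_coeff N k) * multiplier \<beta> k * cis (real_of_int k * x))" for x
  have \<phi>: "complex_of_real (\<phi> x) = (\<Sum>k\<in>?A. complex_of_real (fejer_coeff N k) * cis (real_of_int k * x))" for x
    unfolding \<phi>_def by (rule real_trig_polynomial) (auto simp: fejer_coeff_def)
  have f: "complex_of_real (f x) = (\<Sum>k\<in>?A. complex_of_real (fejer_coeff N k) * multiplier \<beta> k * cis (real_of_int k * x))" for x
    unfolding f_def by (rule real_trig_polynomial) (auto simp: fejer_coeff_def multiplier_def cis_cnj sgn_minus)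
  have c\<phi>: "fourier_coeff \<phi> k = (if k \<in> ?A then complex_of_real (fejer_coeff N k) else 0)" for k
    by (rule fourier_coeff_trig_polynomial[OF _ \<phi>]) simp
  have cf: "fourier_coeff f k = (if k \<in> ?A then complex_of_real (fejer_coeff N k) * multiplier \<beta> k else 0)" for k
    by (rule fourier_coeff_trig_polynomial[OF _ f]) simp
  have B0: "\<phi> \<in> B0 1" by (rule fejer_extremal_in_B0[OF N \<phi>])
  have "is_psi_beta_deriv \<psi> \<beta> f \<phi>"
    unfolding is_psi_beta_deriv_def
  proof (intro conjI allI impI)
    show "in_Lp 1 \<phi>" by (rule trig_polynomial_in_Lp_1[OF \<phi>])
    show "fourier_coeff \<phi> 0 = 0" by (simp add: c\<phi>)
    fix k :: int assume k: "k \<noteq> 0"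
    then have "\<psi> (real_of_int \<bar>k\<bar>) > 0" by (intro psi_pos) auto
    then show "fourier_coeff \<phi> k = fourier_coeff f k / complex_of_real (\<psi> (real_of_int \<bar>k\<bar>)) * cis (\<beta> * pi / 2 * real_of_int (sgn k))"
      by (simp add: c\<phi> cf multiplier_def cis_mult)
  qed
  moreover have "in_Lp 1 f" by (rule trig_polynomial_in_Lp_1[OF f])
  ultimately show thesis using that[of f] f B0 by (auto simp: L_class_def)
qed

text \<open>The function is chosen from n alone, before the removed set, and works against every
  \<gamma> with at most 2n elements; this settles 2n - 1 and 2n together. A remainder norm below X
  would make the pairing at most half of its actual size.\<close>

lemma e_orth_class_lower:
  assumes s: "s > 1"
  shows "\<exists>c>0. \<forall>n\<ge>1. \<forall>m\<le>2 * n. ennreal (c * (\<psi> (real n) * lam (real n) powr (1 - 1 / s)))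
      \<le> e_orth_class m (L_class \<psi> \<beta> 1) s"
proof -
  define q where "q = s / (s - 1)"
  have q: "q > 1" "1 / s + 1 / q = 1" using s by (auto simp: q_def field_simps)
  obtain Y where Y: "Y > 0" "\<And>n M. n \<ge> 1 \<Longrightarrow> real M > eta \<psi> (real n) \<Longrightarrow> real M \<le> eta \<psi> (real n) + 1 \<Longrightarrow>
    (\<integral>\<^sup>+x\<in>{-pi..pi}. ennreal (cmod (\<Sum>k\<in>{- int M..int M} - {0}. test_coeff \<beta> n k * cis (real_of_int (- k) * x)) powr q) \<partial>lborel)
      \<le> ennreal ((Y * lam (real n) powr (1 - 1 / q)) powr q)"
    using test_function_Lp_bound[OF q(1), of \<beta>] by blast
  \<comment> \<open>With this c, Holder's bound for the pairing is psi(n) lam(n) / 4, while the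
    surviving frequencies force at least psi(n) lam(n) / 2.\<close>
  define c where "c = 1 / (4 * Y)"
  have c: "c > 0" using Y by (simp add: c_def)
  have "ennreal (c * (\<psi> (real n) * lam (real n) powr (1 - 1 / s))) \<le> e_orth_class m (L_class \<psi> \<beta> 1) s"
    if n: "n \<ge> 1" and m: "m \<le> 2 * n" for n m
  proof -
    define X where "X = c * (\<psi> (real n) * lam (real n) powr (1 - 1 / s))"
    have ln: "lam (real n) > 0" "\<psi> (real n) > 0" using lam_pos psi_pos n by auto
    have X: "X > 0" using c ln by (simp add: X_def)
    define M where "M = nat (\<lfloor>eta \<psi> (real n)\<rfloor> + 1)"
    have e: "eta \<psi> (real n) > real n" using eta_props n by auto
    have M: "real M > eta \<psi> (real n)" "real M \<le> eta \<psi> (real n) + 1"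
      using e n unfolding M_def by linarith+
    have M1: "M \<ge> 1" "M > n" using M e by linarith+
    \<comment> \<open>Doubling M keeps the Fejer weight 1 - |k| / N at least 1/2 for all |k| up to
      M.\<close>
    define N where "N = 2 * M"
    let ?A = "{- int N<..<int N} - {0}"
    define a where "a k = complex_of_real (fejer_coeff N k) * multiplier \<beta> k" for k
    have "N \<ge> 1" using M1 by (simp add: N_def)
    then obtain f where fL: "f \<in> L_class \<psi> \<beta> 1"
      and f: "\<And>x. complex_of_real (f x) = (\<Sum>k\<in>?A. a k * cis (real_of_int k * x))"
      using extremal_function[of N \<beta>] unfolding a_def by blast
    have fc: "fourier_coeff f k = (if k \<in> ?A then a k else 0)" for k
      by (rule fourier_coeff_trig_polynomial[OF _ f]) simp
    have "ennreal X \<le> Lp_norm s (\<lambda>x. complex_of_real (f x) - (\<Sum>k\<in>\<gamma>. fourier_coeff f k * cis (real_of_int k * x)))"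
      if \<gamma>: "finite \<gamma>" "card \<gamma> = m" for \<gamma>
    proof (rule ccontr)
      let ?r = "\<lambda>x. complex_of_real (f x) - (\<Sum>k\<in>\<gamma>. fourier_coeff f k * cis (real_of_int k * x))"
      let ?R = "\<lambda>x. \<Sum>k\<in>?A - \<gamma>. a k * cis (real_of_int k * x)"
      let ?G = "{- int M..int M} - {0}"
      let ?g = "\<lambda>x. \<Sum>k\<in>?G. test_coeff \<beta> n k * cis (real_of_int (- k) * x)"
      assume "\<not> ennreal X \<le> Lp_norm s ?r"
      then have small: "Lp_norm s ?r \<le> ennreal X" by simp
      \<comment> \<open>The set \<gamma> may contain frequencies outside the spectrum of f; their
        coefficients are 0, so such choices remove nothing.\<close>
      have r: "?r = ?R"
      proof
        fix x
        have "(\<Sum>k\<in>\<gamma>. fourier_coeff f k * cis (real_of_int k * x)) = (\<Sum>k\<in>?A \<inter> \<gamma>. a k * cis (real_of_int k * x))"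
          by (rule sum.mono_neutral_cong_right) (use \<gamma> in \<open>auto simp: fc\<close>)
        moreover have "(\<Sum>k\<in>?A. a k * cis (real_of_int k * x))
          = (\<Sum>k\<in>?A - \<gamma>. a k * cis (real_of_int k * x)) + (\<Sum>k\<in>?A \<inter> \<gamma>. a k * cis (real_of_int k * x))"
          by (subst sum.union_disjoint[symmetric]) (auto intro!: sum.cong)
        ultimately show "?r x = ?R x" by (simp add: f)
      qed
      have intR: "(\<integral>\<^sup>+x\<in>{-pi..pi}. ennreal (cmod (?R x) powr s) \<partial>lborel) \<le> ennreal (X powr s)"
        using small s X unfolding r
        by (subst (asm) Lp_norm_le_iff) (auto simp: trig_polynomial_periodic)
      have Rb: "set_integrable lborel {-pi..pi} (\<lambda>x. ?R x * (test_coeff \<beta> n k * cis (real_of_int (- k) * x)))" for k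
        by (rule set_integrable_bounded_circle[where B = "(\<Sum>k\<in>?A - \<gamma>. cmod (a k)) * cmod (test_coeff \<beta> n k)"])
           (auto simp: norm_mult intro!: mult_right_mono trig_polynomial_bound)
      have pair: "?R x * ?g x = (\<Sum>k\<in>?G. ?R x * (test_coeff \<beta> n k * cis (real_of_int (- k) * x)))" for x
        by (simp only: sum_distrib_left)
      have iRg: "set_integrable lborel {-pi..pi} (\<lambda>x. ?R x * ?g x)"
        unfolding pair set_integrable_def scaleR_sum_right
        by (rule Bochner_Integration.integrable_sum) (rule Rb[unfolded set_integrable_def])
      have le: "cmod (LINT x:{-pi..pi}|lborel. ?R x * ?g x) \<le> X * (Y * lam (real n) powr (1 - 1 / q))"
        by (rule integral_pairing_le[OF s q X _ _ _ iRg intR Y(2)[OF n M]])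
           (use Y ln in \<open>simp, measurable\<close>)
      have pairing: "(LINT x:{-pi..pi}|lborel. ?R x * (test_coeff \<beta> n k * cis (real_of_int (- k) * x)))
         = complex_of_real (if k \<in> \<gamma> then 0 else 2 * pi * (\<psi> (real n) * fejer_coeff N k))" if k: "k \<in> ?G" for k
      proof -
        have "(LINT x:{-pi..pi}|lborel. ?R x * (test_coeff \<beta> n k * cis (real_of_int (- k) * x)))
           = test_coeff \<beta> n k * (LINT x:{-pi..pi}|lborel. ?R x * cis (real_of_int (- k) * x))"
          by (subst set_integral_mult_right[symmetric]) (simp only: ac_simps)
        also have "\<dots> = test_coeff \<beta> n k * (if k \<in> ?A - \<gamma> then 2 * complex_of_real pi * a k else 0)"
          by (subst integral_trig_polynomial_cis) auto
        finally have 1: "(LINT x:{-pi..pi}|lborel. ?R x * (test_coeff \<beta> n k * cis (real_of_int (- k) * x)))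
           = test_coeff \<beta> n k * (if k \<in> ?A - \<gamma> then 2 * complex_of_real pi * a k else 0)" .
        have "k \<in> ?A" using k M1 by (auto simp: N_def)
        moreover have "test_coeff \<beta> n k * a k = complex_of_real (\<psi> (real n) * fejer_coeff N k)"
        proof -
          have "\<psi> (real_of_int \<bar>k\<bar>) > 0" using k by (intro psi_pos) auto
          moreover have "cis (\<beta> * pi / 2 * real_of_int (sgn k)) * cis (- (\<beta> * pi / 2 * real_of_int (sgn k))) = 1"
            by (simp add: cis_mult)
          ultimately show ?thesis
            by (simp add: test_coeff_def a_def multiplier_def del: cis_mult)
        qed
        ultimately show ?thesis unfolding 1 by simp
      qed
      have v: "fejer_coeff N k \<ge> 1 / (8 * pi)" if "k \<in> ?G" for k
      proof -
        have "\<bar>real_of_int k\<bar> \<le> real M" using that by auto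
        then have "1 - \<bar>real_of_int k\<bar> / real N \<ge> 1 / 2" using M1 by (simp add: N_def field_simps)
        then have "(1 - \<bar>real_of_int k\<bar> / real N) / (4 * pi) \<ge> 1 / 2 / (4 * pi)" by (intro divide_right_mono) auto
        then show ?thesis by (simp add: fejer_coeff_def)
      qed
      have "(LINT x:{-pi..pi}|lborel. ?R x * ?g x)
         = (\<Sum>k\<in>?G. LINT x:{-pi..pi}|lborel. ?R x * (test_coeff \<beta> n k * cis (real_of_int (- k) * x)))"
        unfolding pair set_lebesgue_integral_def scaleR_sum_right
        by (rule Bochner_Integration.integral_sum) (rule Rb[unfolded set_integrable_def])
      also have "\<dots> = complex_of_real (\<Sum>k\<in>?G. if k \<in> \<gamma> then 0 else 2 * pi * (\<psi> (real n) * fejer_coeff N k))"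
        unfolding of_real_sum by (rule sum.cong[OF refl pairing])
      also have "(\<Sum>k\<in>?G. if k \<in> \<gamma> then 0 else 2 * pi * (\<psi> (real n) * fejer_coeff N k))
         = (\<Sum>k\<in>?G - \<gamma>. 2 * pi * (\<psi> (real n) * fejer_coeff N k))"
        by (rule sum.mono_neutral_cong_right) auto
      finally have int_eq: "(LINT x:{-pi..pi}|lborel. ?R x * ?g x)
         = complex_of_real (\<Sum>k\<in>?G - \<gamma>. 2 * pi * (\<psi> (real n) * fejer_coeff N k))" .
      have "card ?G = 2 * M" by (subst card_Diff_singleton) auto
      then have "card (?G - \<gamma>) \<ge> 2 * M - m"
        using diff_card_le_card_Diff[OF \<gamma>(1), of ?G] \<gamma>(2) by simp
      then have "real (card (?G - \<gamma>)) \<ge> 2 * real M - 2 * real n" using m M1 by linarith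
      then have "2 * lam (real n) \<le> real (card (?G - \<gamma>))" using M by (simp add: lam_def)
      \<comment> \<open>Each survivor contributes at least 2 pi psi(n) / (8 pi) = psi(n) / 4. All
        contributions are real and positive, so none cancel.\<close>
      then have "\<psi> (real n) * lam (real n) / 2 \<le> real (card (?G - \<gamma>)) * (\<psi> (real n) / 4)"
        using ln mult_right_mono[of "2 * lam (real n)" "real (card (?G - \<gamma>))" "\<psi> (real n) / 4"] by (simp add: mult.commute)
      also have "\<dots> \<le> (\<Sum>k\<in>?G - \<gamma>. 2 * pi * (\<psi> (real n) * fejer_coeff N k))"
      proof (rule sum_bounded_below)
        fix k assume "k \<in> ?G - \<gamma>"
        then have "2 * pi * (\<psi> (real n) * (1 / (8 * pi))) \<le> 2 * pi * (\<psi> (real n) * fejer_coeff N k)"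
          using v[of k] ln by (intro mult_left_mono) auto
        then show "\<psi> (real n) / 4 \<le> 2 * pi * (\<psi> (real n) * fejer_coeff N k)" by simp
      qed
      also have "\<dots> \<le> cmod (LINT x:{-pi..pi}|lborel. ?R x * ?g x)"
        unfolding int_eq by (simp only: norm_of_real abs_ge_self)
      also note le
      \<comment> \<open>The exponents 1 - 1/s and 1 - 1/q add up to 1, which leaves lam(n) to the
        first power.\<close>
      also have "X * (Y * lam (real n) powr (1 - 1 / q)) = \<psi> (real n) * lam (real n) / 4"
      proof -
        have "lam (real n) powr (1 - 1 / s) * lam (real n) powr (1 - 1 / q) = lam (real n)"
        proof -
          have "1 - 1 / s + (1 - 1 / q) = 1" using q(2) by simp
          then show ?thesis using ln by (simp only: powr_add[symmetric]) simp
        qed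
        then have "X * (Y * lam (real n) powr (1 - 1 / q)) = c * Y * \<psi> (real n) * lam (real n)"
          unfolding X_def by (metis (no_types, opaque_lifting) mult.assoc mult.commute)
        then show ?thesis using Y by (simp add: c_def)
      qed
      finally show False using ln by simp
    qed
    then have "ennreal X \<le> e_orth m f s"
      unfolding e_orth_def by (intro INF_greatest) auto
    also have "\<dots> \<le> e_orth_class m (L_class \<psi> \<beta> 1) s"
      unfolding e_orth_class_def by (rule SUP_upper[OF fL])
    finally show ?thesis by (simp add: X_def)
  qed
  then show ?thesis using c by blast
qed

end

theorem theorem3:
  fixes s s' :: real and \<psi> \<psi>' :: "real \<Rightarrow> real"
  assumes "1 < s" and "1 / s + 1 / s' = 1"
    and "\<psi> \<in> class_M_pp_inf"
    and "\<forall>t\<ge>1. (\<psi> has_real_derivative \<psi>' t) (at t within {1..})"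
    and "mono_on {1..} (\<lambda>t. \<psi> t / \<bar>\<psi>' t\<bar>)"
    and "filterlim (\<lambda>t. \<psi> t / \<bar>\<psi>' t\<bar>) at_top at_top"
  shows "\<forall>\<beta>::real. \<exists>C1>0. \<exists>C2>0. \<forall>n::nat. n \<ge> 1 \<longrightarrow>
     (let a = \<psi> (real n) * (eta \<psi> (real n) - real n) powr (1 / s') in
        ennreal (C1 * a) \<le> e_orth_class (2*n - 1) (L_class \<psi> \<beta> 1) s \<and>
        e_orth_class (2*n - 1) (L_class \<psi> \<beta> 1) s \<le> ennreal (C2 * a) \<and>
        ennreal (C1 * a) \<le> e_orth_class (2*n) (L_class \<psi> \<beta> 1) s \<and>
        e_orth_class (2*n) (L_class \<psi> \<beta> 1) s \<le> ennreal (C2 * a))"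
proof
  fix \<beta> :: real
  interpret rapidly_decaying \<psi> \<psi>'
    using assms by unfold_locales
  have s': "1 / s' = 1 - 1 / s" using assms(2) by simp
  obtain C1 where C1: "C1 > 0" "\<forall>n\<ge>1. \<forall>m\<le>2 * n. ennreal (C1 * (\<psi> (real n) * lam (real n) powr (1 - 1 / s)))
      \<le> e_orth_class m (L_class \<psi> \<beta> 1) s"
    using e_orth_class_lower[OF assms(1)] by blast
  obtain C2 where C2: "C2 > 0" "\<forall>n\<ge>1. \<forall>m\<in>{2 * n - 1, 2 * n}. e_orth_class m (L_class \<psi> \<beta> 1) s
      \<le> ennreal (C2 * (\<psi> (real n) * lam (real n) powr (1 - 1 / s)))"
    using e_orth_class_upper[OF assms(1)] by blast
  show "\<exists>C1>0. \<exists>C2>0. \<forall>n::nat. n \<ge> 1 \<longrightarrow>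
     (let a = \<psi> (real n) * (eta \<psi> (real n) - real n) powr (1 / s') in
        ennreal (C1 * a) \<le> e_orth_class (2*n - 1) (L_class \<psi> \<beta> 1) s \<and>
        e_orth_class (2*n - 1) (L_class \<psi> \<beta> 1) s \<le> ennreal (C2 * a) \<and>
        ennreal (C1 * a) \<le> e_orth_class (2*n) (L_class \<psi> \<beta> 1) s \<and>
        e_orth_class (2*n) (L_class \<psi> \<beta> 1) s \<le> ennreal (C2 * a))"
    using C1 C2 unfolding s' Let_def lam_def
    by (intro exI[of _ C1] exI[of _ C2] conjI allI impI) auto
qed

end
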